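(* Let $G$ and $H$ be groups in Wright's class $\mathscr{C}$. Suppose that $G_1$ and $H_1$ are the corresponding nilpotent subgroups of $G$ and $H$ respectively (so $\mu(G_1)=\mu(G)$ and $\mu(H_1)=\mu(H)$), such that they have odd order with $$Z(G)=Z(G_1)\cong Z(H)=Z(H_1)\cong\prod_{i=1}^r C_{p_i^{\alpha_i}},$$ for distinct odd primes $p_i$. Express $G_1=\prod_{i=1}^r G_{p_i}$ and $H_1=\prod_{i=1}^r H_{p_i}$, where the $G_{p_i}$ and the $H_{p_i}$ are the Sylow $p_i$-subgroups of $G_1$ and $H_1$ respectively. Then $G\times H$ is exceptional with distinguished quotient the central product $G\circ H$; that is, $\mu(G\circ H)>\mu(G\times H)$.
   Context: For a finite group $G$, $\mu(G)$ denotes the minimal faithful permutation degree of $G$: the least non-negative integer $m$ such that $G$ embeds in $\mathrm{Sym}(m)$. Wright's class $\mathscr{C}$ is the class of finite groups $G$ that possess a nilpotent subgroup $G_1$ with $\mu(G_1)=\mu(G)$. A finite group $K$ is exceptional if it has a normal subgroup $N$ with $\mu(K/N)>\mu(K)$; then $K/N$ is called a distinguished quotient. $C_m$ is the cyclic group of order $m$ and $Z(G)$ is the centre of $G$. If $Z(G)\cong Z(H)$, identify both centres with a common group $Z$ via a fixed isomorphism; the central product is $G\circ H=(G\times H)/\{(z,z): z\in Z\}$.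
   Formalization: Proved with r ≥ 1 and with every Sylow subgroup G_{p_i}, H_{p_i} assumed non-abelian; without this the claim is false, e.g. G = H = C_3 gives μ(G∘H) = 3 < 6 = μ(G×H). *)

theory Defs
  imports "HOL-Algebra.Algebra" "HOL-Algebra.Product_Groups" "HOL-Algebra.Sym_Groups"
begin

abbreviation subgroup_structure :: "('a, 'm) monoid_scheme \<Rightarrow> 'a set \<Rightarrow> ('a, 'm) monoid_scheme"
    (infixl \<open>\<restriction>\<^sub>G\<close> 95)
  where "G \<restriction>\<^sub>G S \<equiv> G\<lparr>carrier := S\<rparr>"

(* sym_group m acts on {1..m}.  For a finite group the set of such m is nonempty by Cayley's
   theorem; mu is only meant to be applied to finite groups. *)
definition mu :: "('a, 'm) monoid_scheme \<Rightarrow> nat"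
  where "mu G = (LEAST m. mon G (sym_group m) \<noteq> {})"

primrec lower_central_series :: "('a, 'm) monoid_scheme \<Rightarrow> nat \<Rightarrow> 'a set" where
  "lower_central_series G 0 = carrier G"
| "lower_central_series G (Suc n) =
     generate G {x \<otimes>\<^bsub>G\<^esub> y \<otimes>\<^bsub>G\<^esub> inv\<^bsub>G\<^esub> x \<otimes>\<^bsub>G\<^esub> inv\<^bsub>G\<^esub> y | x y.
                   x \<in> lower_central_series G n \<and> y \<in> carrier G}"

definition nilpotent_group :: "('a, 'm) monoid_scheme \<Rightarrow> bool"
  where "nilpotent_group G \<longleftrightarrow> group G \<and> (\<exists>n. lower_central_series G n = {\<one>\<^bsub>G\<^esub>})"

definition wright_subgroup :: "('a, 'm) monoid_scheme \<Rightarrow> 'a set \<Rightarrow> bool"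
  where "wright_subgroup G G1 \<longleftrightarrow>
    subgroup G1 G \<and> nilpotent_group (G \<restriction>\<^sub>G G1) \<and> mu (G \<restriction>\<^sub>G G1) = mu G"

definition wright_class :: "('a, 'm) monoid_scheme \<Rightarrow> bool"
  where "wright_class G \<longleftrightarrow> group G \<and> finite (carrier G) \<and> (\<exists>G1. wright_subgroup G G1)"

(* The distinguished quotient is K Mod N; we record its kernel N. *)
definition distinguished_kernel :: "('a, 'm) monoid_scheme \<Rightarrow> 'a set \<Rightarrow> bool"
  where "distinguished_kernel K N \<longleftrightarrow> N \<lhd> K \<and> mu (K Mod N) > mu K"

definition exceptional :: "('a, 'm) monoid_scheme \<Rightarrow> bool"
  where "exceptional K \<longleftrightarrow> group K \<and> finite (carrier K) \<and> (\<exists>N. distinguished_kernel K N)"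

definition center :: "('a, 'm) monoid_scheme \<Rightarrow> 'a set"
  where "center G = {z \<in> carrier G. \<forall>x\<in>carrier G. x \<otimes>\<^bsub>G\<^esub> z = z \<otimes>\<^bsub>G\<^esub> x}"

definition sylow_subgroup :: "nat \<Rightarrow> ('a, 'm) monoid_scheme \<Rightarrow> 'a set \<Rightarrow> bool"
  where "sylow_subgroup p G P \<longleftrightarrow> subgroup P G \<and> card P = p ^ multiplicity p (order G)"

(* The kernel {(z, z)} of the central product, where \<phi> is the fixed isomorphism from the centre
   of G to the centre of H along which both are identified. *)
definition central_kernel :: "('a, 'm) monoid_scheme \<Rightarrow> ('a \<Rightarrow> 'b) \<Rightarrow> ('a \<times> 'b) set"
  where "central_kernel G \<phi> = {(z, \<phi> z) | z. z \<in> center G}"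

definition central_product ::
    "('a, 'm) monoid_scheme \<Rightarrow> ('b, 'n) monoid_scheme \<Rightarrow> ('a \<Rightarrow> 'b) \<Rightarrow> ('a \<times> 'b) set monoid"
  where "central_product G H \<phi> = (G \<times>\<times> H) Mod central_kernel G \<phi>"

end

theory Submission
  imports Defs
begin

text \<open>
  Juxtaposing permutation representations shows \<open>mu (G \<times>\<times> H) \<le> mu G + mu H\<close>, so it is enough
  to prove that every faithful action of the central product on \<open>m\<close> points satisfies
  \<open>mu G + mu H < m\<close>. Such an action restricts to the subgroup generated by the images of \<open>G1\<close>
  and \<open>H1\<close>. The centres of \<open>G1\<close> and \<open>H1\<close> are those of \<open>G\<close> and \<open>H\<close>, so one obtains an action of
  \<open>G1 \<times>\<times> H1\<close> whose kernel is exactly the graph of \<open>\<phi>\<close>, and \<open>mu G = mu G1\<close>, \<open>mu H = mu H1\<close>. From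
  now on only the nilpotent groups \<open>G1\<close> and \<open>H1\<close> matter.

  Their centres are cyclic, so for each \<open>i\<close> the central elements of order \<open>p i\<close> are powers of a
  single element \<open>z i\<close> of \<open>G1\<close>, and of \<open>w i = \<phi> (z i)\<close> in \<open>H1\<close>. Let \<open>d i\<close> be the least index in the
  Sylow subgroup \<open>GP i\<close> of a subgroup that does not contain \<open>z i\<close>, and define \<open>e i\<close> for \<open>w i\<close> and
  \<open>HP i\<close> in the same way. A nontrivial normal subgroup of a nilpotent group meets the centre, hence
  contains some \<open>z i\<close>. Therefore subgroups that realize the \<open>d i\<close> have trivial common core, and
  \<open>mu G1 \<le> (\<Sum>i. d i)\<close>; likewise for \<open>H1\<close> (\<open>mu_le_sum_sylow_index\<close>).

  In the given action, \<open>(z i, 1)\<close> moves some point, whose stabilizer \<open>L\<close> contains \<open>(z i, w i)\<close> but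
  not \<open>(z i, 1)\<close>. The crucial fact is that the index of such an \<open>L\<close> is divisible by a power of
  \<open>p i\<close> that is at least \<open>p i * max (d i) (e i)\<close> (\<open>p_local_index\<close>). To see it, intersect \<open>L\<close> with
  \<open>GP i \<times> HP i\<close> and apply Goursat's analysis. The index of the intersection is the product of the
  index of its slice \<open>{g. (g, 1) \<in> L}\<close> in \<open>GP i\<close>, which is at least \<open>d i\<close>, with the index of its
  projection in \<open>HP i\<close>. If the projection is not surjective, the second factor contributes
  \<open>p i\<close>. If it is surjective, the intersection is the graph of a homomorphism from a subgroup
  of \<open>GP i\<close> onto \<open>HP i\<close>, and the slice is its kernel. Then the slice is far from optimal: \<open>HP i\<close>,
  being nonabelian of odd order with cyclic centre, has a noncentral element of order \<open>p i\<close>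
  (\<open>p_group_noncentral_element_of_order_p\<close>), and the preimage of the subgroup that it
  generates still avoids \<open>z i\<close> but is \<open>p i\<close> times as large (\<open>twisted_subgroup_index\<close>).

  Finally, an orbit that serves several primes is at least as large as the product, hence as the
  sum, of the corresponding prime powers (\<open>sum_index_bounds_le_degree\<close>). Since each \<open>p i\<close> is at
  least three, \<open>m \<ge> (\<Sum>i. 3 * max (d i) (e i)) > (\<Sum>i. d i + e i) \<ge> mu G1 + mu H1\<close>.
\<close>

section \<open>Commutators in nilpotent groups\<close>

text \<open>The order of the factors is the one in the definition of the lower central series.\<close>

definition gcomm :: "('a, 'm) monoid_scheme \<Rightarrow> 'a \<Rightarrow> 'a \<Rightarrow> 'a"
  where "gcomm G x y = x \<otimes>\<^bsub>G\<^esub> y \<otimes>\<^bsub>G\<^esub> inv\<^bsub>G\<^esub> x \<otimes>\<^bsub>G\<^esub> inv\<^bsub>G\<^esub> y"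

context group
begin

lemma gcomm_closed [simp]: "x \<in> carrier G \<Longrightarrow> y \<in> carrier G \<Longrightarrow> gcomm G x y \<in> carrier G"
  by (simp add: gcomm_def)

lemma gcomm_swap:
  assumes "x \<in> carrier G" "y \<in> carrier G"
  shows "x \<otimes> y = gcomm G x y \<otimes> (y \<otimes> x)"
  using assms by (simp add: gcomm_def m_assoc) (simp add: m_assoc[symmetric])

lemma gcomm_eq_one_iff:
  assumes "x \<in> carrier G" "y \<in> carrier G"
  shows "gcomm G x y = \<one> \<longleftrightarrow> x \<otimes> y = y \<otimes> x"
  using assms gcomm_swap[OF assms] by (metis gcomm_closed l_one m_closed r_cancel_one')

lemma gcomm_conj:
  assumes "x \<in> carrier G" "y \<in> carrier G" "g \<in> carrier G"
  shows "g \<otimes> gcomm G x y \<otimes> inv g = gcomm G (g \<otimes> x \<otimes> inv g) (g \<otimes> y \<otimes> inv g)"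
proof -
  have "inv g \<otimes> (g \<otimes> a) = a" if "a \<in> carrier G" for a
    using that assms by (simp add: m_assoc[symmetric])
  thus ?thesis using assms by (simp add: gcomm_def inv_mult_group m_assoc)
qed

lemma lower_central_series_normal: "lower_central_series G n \<lhd> G"
proof (induction n)
  case 0
  show ?case using normal_invI[OF subgroup_self] by simp
next
  case (Suc n)
  have sub: "lower_central_series G n \<subseteq> carrier G"
    using Suc normal_imp_subgroup subgroup.subset by blast
  show ?case unfolding lower_central_series.simps gcomm_def[symmetric]
  proof (rule normal_generateI)
    show "{gcomm G x y |x y. x \<in> lower_central_series G n \<and> y \<in> carrier G} \<subseteq> carrier G"
      using sub by auto
    fix h g assume "h \<in> {gcomm G x y |x y. x \<in> lower_central_series G n \<and> y \<in> carrier G}"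
      and g: "g \<in> carrier G"
    then obtain x y where h: "h = gcomm G x y" "x \<in> lower_central_series G n" "y \<in> carrier G"
      by blast
    have "g \<otimes> x \<otimes> inv g \<in> lower_central_series G n" using Suc h g normal_invE(2) by blast
    moreover have "g \<otimes> h \<otimes> inv g = gcomm G (g \<otimes> x \<otimes> inv g) (g \<otimes> y \<otimes> inv g)"
      using h g sub gcomm_conj by auto
    ultimately show "g \<otimes> h \<otimes> inv g \<in> {gcomm G x y |x y. x \<in> lower_central_series G n \<and> y \<in> carrier G}"
      using h g by blast
  qed
qed

lemma lower_central_series_gcomm:
  assumes "x \<in> lower_central_series G n" "y \<in> carrier G"
  shows "gcomm G x y \<in> lower_central_series G (Suc n)"
  using assms unfolding lower_central_series.simps gcomm_def[symmetric]
  by (blast intro: generate.incl)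

text \<open>Commutators with arbitrary elements move down the lower central series, so every chain
  of iterated nontrivial commutators is finite: in a nilpotent group one may assume a
  property for all nontrivial commutators of an element when proving it for the element
  itself.\<close>

lemma nilpotent_gcomm_induct:
  assumes nil: "nilpotent_group G" and x: "x \<in> carrier G" "x \<noteq> \<one>"
    and step: "\<And>x. \<lbrakk>x \<in> carrier G; x \<noteq> \<one>;
                \<And>y. y \<in> carrier G \<Longrightarrow> gcomm G x y \<noteq> \<one> \<Longrightarrow> Q (gcomm G x y)\<rbrakk> \<Longrightarrow> Q x"
  shows "Q x"
proof -
  obtain n where n: "lower_central_series G n = {\<one>}"
    using nil by (auto simp: nilpotent_group_def)
  have "\<forall>x\<in>lower_central_series G k. x \<noteq> \<one> \<longrightarrow> Q x" if "k \<le> n" for k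
    using that
  proof (induction k rule: inc_induct)
    case base thus ?case using n by auto
  next
    case (step k)
    show ?case
    proof (intro ballI impI)
      fix x assume x: "x \<in> lower_central_series G k" "x \<noteq> \<one>"
      have "x \<in> carrier G"
        using x lower_central_series_normal normal_imp_subgroup subgroup.mem_carrier by metis
      thus "Q x" using x lower_central_series_gcomm step.IH assms(4) by blast
    qed
  qed
  from this[of 0] x show ?thesis by simp
qed

lemma subgroup_restrict_gcomm:
  assumes "subgroup H G" "x \<in> H" "y \<in> H"
  shows "gcomm (G\<lparr>carrier := H\<rparr>) x y = gcomm G x y"
  using assms by (simp add: gcomm_def m_inv_consistent)

lemma lower_central_series_subgroup:
  assumes H: "subgroup H G"
  shows "lower_central_series (G\<lparr>carrier := H\<rparr>) n \<subseteq> lower_central_series G n"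
proof (induction n)
  case 0 show ?case using subgroup.subset[OF H] by simp
next
  case (Suc n)
  interpret H: group "G\<lparr>carrier := H\<rparr>" using H subgroup_imp_group by blast
  have sub: "lower_central_series (G\<lparr>carrier := H\<rparr>) n \<subseteq> H"
    using H.lower_central_series_normal[of n] normal_imp_subgroup subgroup.subset by fastforce
  let ?C = "{gcomm (G\<lparr>carrier := H\<rparr>) x y |x y. x \<in> lower_central_series (G\<lparr>carrier := H\<rparr>) n \<and> y \<in> H}"
  have C: "?C \<subseteq> lower_central_series G (Suc n)"
    using Suc sub subgroup.mem_carrier[OF H] lower_central_series_gcomm
    by (auto simp: subgroup_restrict_gcomm[OF H] subset_iff simp del: lower_central_series.simps)
  have "?C \<subseteq> H" using H.gcomm_closed sub by auto
  hence "generate (G\<lparr>carrier := H\<rparr>) ?C = generate G ?C" using generate_consistent H by blast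
  also have "\<dots> \<subseteq> lower_central_series G (Suc n)"
    using generate_subgroup_incl[OF C] lower_central_series_normal normal_imp_subgroup by blast
  finally show ?case by (simp add: gcomm_def)
qed

lemma nilpotent_subgroup:
  assumes "nilpotent_group G" "subgroup H G"
  shows "nilpotent_group (G\<lparr>carrier := H\<rparr>)"
proof -
  interpret H: group "G\<lparr>carrier := H\<rparr>" using assms subgroup_imp_group by blast
  obtain n where n: "lower_central_series G n = {\<one>}"
    using assms by (auto simp: nilpotent_group_def)
  have "\<one> \<in> lower_central_series (G\<lparr>carrier := H\<rparr>) n"
    using H.lower_central_series_normal[of n] normal_imp_subgroup subgroup.one_closed by fastforce
  hence "lower_central_series (G\<lparr>carrier := H\<rparr>) n = {\<one>}"
    using lower_central_series_subgroup[OF assms(2), of n] n by auto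
  thus ?thesis unfolding nilpotent_group_def using H.is_group by auto
qed

text \<open>Commutators of an element of a normal subgroup stay in that subgroup. The last
  nontrivial one in a chain of iterated commutators is central.\<close>

lemma nilpotent_normal_meets_center:
  assumes "nilpotent_group G" "N \<lhd> G" "N \<noteq> {\<one>}"
  obtains z where "z \<in> N" "z \<in> center G" "z \<noteq> \<one>"
proof -
  have N: "subgroup N G" using assms normal_imp_subgroup by blast
  obtain x where x: "x \<in> N" "x \<noteq> \<one>"
    using assms(3) subgroup.one_closed[OF N] by auto
  have "x \<in> N \<longrightarrow> (\<exists>z\<in>N. z \<in> center G \<and> z \<noteq> \<one>)"
  proof (rule nilpotent_gcomm_induct[OF assms(1), where x = x])
    show "x \<in> carrier G" using x N subgroup.mem_carrier by metis
    show "x \<noteq> \<one>" by fact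
    fix x assume x: "x \<in> carrier G" "x \<noteq> \<one>"
      and IH: "\<And>y. y \<in> carrier G \<Longrightarrow> gcomm G x y \<noteq> \<one> \<Longrightarrow>
              gcomm G x y \<in> N \<longrightarrow> (\<exists>z\<in>N. z \<in> center G \<and> z \<noteq> \<one>)"
    show "x \<in> N \<longrightarrow> (\<exists>z\<in>N. z \<in> center G \<and> z \<noteq> \<one>)"
    proof
      assume xN: "x \<in> N"
      show "\<exists>z\<in>N. z \<in> center G \<and> z \<noteq> \<one>"
      proof (cases "\<forall>y\<in>carrier G. gcomm G x y = \<one>")
        case True
        hence "x \<in> center G" using x by (auto simp: center_def gcomm_eq_one_iff)
        thus ?thesis using x xN by blast
      next
        case False
        then obtain y where y: "y \<in> carrier G" "gcomm G x y \<noteq> \<one>" by blast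
        have "gcomm G x y = x \<otimes> (y \<otimes> inv x \<otimes> inv y)" using x y by (simp add: gcomm_def m_assoc)
        moreover have "y \<otimes> inv x \<otimes> inv y \<in> N"
          using normal_invE(2)[OF assms(2) y(1)] subgroup.m_inv_closed[OF N xN] by blast
        ultimately have "gcomm G x y \<in> N" using subgroup.m_closed[OF N xN] by simp
        thus ?thesis using IH y by blast
      qed
    qed
  qed
  thus ?thesis using that x by blast
qed

end

section \<open>Sylow subgroups of nilpotent groups\<close>

lemma card_eq_image_times_fibre:
  assumes "finite A" "\<And>y. y \<in> f ` A \<Longrightarrow> card {x \<in> A. f x = y} = c"
  shows "card A = card (f ` A) * c"
proof -
  have "card A = (\<Sum>y\<in>f ` A. card {x \<in> A. f x = y})"
    using sum.image_gen[OF assms(1), of "\<lambda>_. 1::nat" f] by simp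
  also have "\<dots> = card (f ` A) * c" using assms(2) by simp
  finally show ?thesis .
qed

lemma prime_power_mult_dvd_le:
  fixes p :: nat
  assumes "Factorial_Ring.prime p" "m dvd p ^ k" "m dvd n" "n > 0"
  shows "m \<le> p ^ multiplicity p n"
proof -
  obtain j where j: "m = p ^ j" using assms divides_primepow_nat by blast
  have "j \<le> multiplicity p n"
    using assms j by (intro multiplicity_geI) (auto simp: prime_gt_1_nat)
  thus ?thesis using j prime_ge_1_nat[OF assms(1)] by (simp add: power_increasing)
qed

context group
begin

lemma card_subgroup_pos: "finite (carrier G) \<Longrightarrow> subgroup H G \<Longrightarrow> card H > 0"
  by (metis card_gt_0_iff empty_iff finite_subset subgroup.one_closed subgroup.subset)

lemma card_subgroup_dvd:
  assumes "subgroup H G" "subgroup K G" "H \<subseteq> K"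
  shows "card H dvd card K"
proof -
  have "card (rcosets\<^bsub>G\<lparr>carrier := K\<rparr>\<^esub> H) * card H = order (G\<lparr>carrier := K\<rparr>)"
    using group.lagrange[OF subgroup_imp_group[OF assms(2)] subgroup_incl[OF assms]] .
  thus ?thesis by (simp add: order_def) (metis dvd_triv_right)
qed

lemma card_set_mult_subgroups:
  assumes H: "subgroup H G" and K: "subgroup K G" and fin: "finite (carrier G)"
  shows "card H * card K = card (H <#> K) * card (H \<inter> K)"
proof -
  note c = subgroup.mem_carrier[OF H] subgroup.mem_carrier[OF K]
  have f: "finite H" "finite K" using fin H K by (meson finite_subset subgroup.subset)+
  have im: "(\<lambda>(h, k). h \<otimes> k) ` (H \<times> K) = H <#> K" by (auto simp: set_mult_def)
  have "card {x \<in> H \<times> K. (case x of (h, k) \<Rightarrow> h \<otimes> k) = y} = card (H \<inter> K)"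
    if "y \<in> (\<lambda>(h, k). h \<otimes> k) ` (H \<times> K)" for y
  proof -
    obtain h k where hk: "h \<in> H" "k \<in> K" "y = h \<otimes> k" using \<open>y \<in> _\<close> by auto
    have "{x \<in> H \<times> K. (case x of (h, k) \<Rightarrow> h \<otimes> k) = y} = (\<lambda>d. (h \<otimes> d, inv d \<otimes> k)) ` (H \<inter> K)"
    proof (rule Set.set_eqI, rule iffI)
      fix x assume "x \<in> {x \<in> H \<times> K. (case x of (h, k) \<Rightarrow> h \<otimes> k) = y}"
      then obtain h' k' where x: "x = (h', k')" "h' \<in> H" "k' \<in> K" "h' \<otimes> k' = h \<otimes> k"
        using hk by auto
      have e: "inv h \<otimes> h' = k \<otimes> inv k'"
        using x hk c by (metis inv_closed inv_solve_left inv_solve_right m_assoc m_closed)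
      have "inv h \<otimes> h' \<in> H \<inter> K"
        using x hk e H K by (metis IntI subgroup.m_closed subgroup.m_inv_closed)
      moreover have "x = (h \<otimes> (inv h \<otimes> h'), inv (inv h \<otimes> h') \<otimes> k)"
      proof -
        have "h \<otimes> (inv h \<otimes> h') = h'" using x hk c by (simp add: m_assoc[symmetric])
        moreover have "inv (inv h \<otimes> h') \<otimes> k = k'"
          unfolding e using x hk c by (simp add: inv_mult_group m_assoc)
        ultimately show ?thesis using x by simp
      qed
      ultimately show "x \<in> (\<lambda>d. (h \<otimes> d, inv d \<otimes> k)) ` (H \<inter> K)" by blast
    next
      fix x assume "x \<in> (\<lambda>d. (h \<otimes> d, inv d \<otimes> k)) ` (H \<inter> K)"
      then obtain d where d: "d \<in> H" "d \<in> K" "x = (h \<otimes> d, inv d \<otimes> k)" by blast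
      have "h \<otimes> d \<otimes> (inv d \<otimes> k) = h \<otimes> k"
        using d hk c by (metis inv_closed m_assoc m_closed r_inv r_one)
      thus "x \<in> {x \<in> H \<times> K. (case x of (h, k) \<Rightarrow> h \<otimes> k) = y}"
        using d hk by (auto intro: subgroup.m_closed[OF H] subgroup.m_closed[OF K] subgroup.m_inv_closed[OF K])
    qed
    moreover have "inj_on (\<lambda>d. (h \<otimes> d, inv d \<otimes> k)) (H \<inter> K)"
      using hk c by (auto intro!: inj_onI)
    ultimately show ?thesis by (simp add: card_image)
  qed
  from card_eq_image_times_fibre[OF _ this] f im show ?thesis
    by (simp add: card_cartesian_product)
qed

text \<open>An element of \<open>p\<close>-power order that normalizes the Sylow subgroup \<open>P\<close> generates together
  with \<open>P\<close> a \<open>p\<close>-subgroup, which cannot exceed \<open>P\<close>.\<close>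

lemma sylow_contains_normalizing_p_element:
  assumes fin: "finite (carrier G)" and p: "Factorial_Ring.prime p" and P: "sylow_subgroup p G P"
    and x: "x \<in> carrier G" "x [^] (p ^ k) = \<one>"
    and norm: "\<And>h. h \<in> P \<Longrightarrow> x \<otimes> h \<otimes> inv x \<in> P"
  shows "x \<in> P"
proof -
  have sP: "subgroup P G" and cP: "card P = p ^ multiplicity p (order G)"
    using P by (auto simp: sylow_subgroup_def)
  have PG: "P \<subseteq> carrier G" using sP subgroup.subset by blast
  \<comment> \<open>The product of P and the cyclic group of x is a subgroup because P is normal in M.\<close>
  define M where "M = normalizer G P"
  have sM: "subgroup M G" unfolding M_def using normalizer_imp_subgroup PG by blast
  interpret M: group "G\<lparr>carrier := M\<rparr>" using sM subgroup_imp_group by blast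
  have PM: "P \<lhd> G\<lparr>carrier := M\<rparr>" unfolding M_def using subgroup_in_normalizer sP by blast
  have "x <# P #> inv x \<subseteq> P" using norm by (auto simp: l_coset_def r_coset_def)
  moreover have "card (x <# P #> inv x) = card P"
  proof -
    have "x <# P #> inv x = (\<lambda>h. x \<otimes> h \<otimes> inv x) ` P" by (auto simp: l_coset_def r_coset_def)
    moreover have "inj_on (\<lambda>h. x \<otimes> h \<otimes> inv x) P"
      using PG x(1) by (auto intro!: inj_onI simp: subset_iff)
    ultimately show ?thesis by (simp add: card_image)
  qed
  ultimately have "x <# P #> inv x = P"
    using card_subset_eq finite_subset[OF PG fin] by blast
  hence xM: "x \<in> M" using x PG by (simp add: M_def normalizer_def stabilizer_def)
  define C where "C = generate G {x}"
  have sC: "subgroup C G" unfolding C_def using generate_is_subgroup x by simp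
  have xC: "x \<in> C" unfolding C_def by (simp add: generate.incl)
  have CM: "C \<subseteq> M" unfolding C_def using generate_subgroup_incl sM xM by simp
  have "subgroup (P <#> C) (G\<lparr>carrier := M\<rparr>)"
    using M.mult_norm_subgroup[OF PM, of C] subgroup_incl[OF sC sM CM] by simp
  hence sPC: "subgroup (P <#> C) G" using incl_subgroup sM by blast
  have cC: "card C dvd p ^ k"
    using generate_pow_card x pow_eq_id unfolding C_def by metis
  have "card (P <#> C) dvd card P * card C"
    using card_set_mult_subgroups[OF sP sC fin] by simp
  also have "\<dots> dvd p ^ (multiplicity p (order G) + k)"
    using cP cC by (simp add: power_add mult_dvd_mono)
  finally have "card (P <#> C) \<le> p ^ multiplicity p (order G)"
    using prime_power_mult_dvd_le[OF p] card_subgroup_dvd[OF sPC subgroup_self] subgroup.subset[OF sPC]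
      order_gt_0_iff_finite fin by (simp add: order_def)
  moreover have sub: "P \<subseteq> P <#> C"
  proof
    fix h assume "h \<in> P"
    hence "h = h \<otimes> \<one>" using PG by auto
    thus "h \<in> P <#> C" using subgroup.one_closed[OF sC] \<open>h \<in> P\<close> unfolding set_mult_def by blast
  qed
  moreover have "finite (P <#> C)" using sPC fin by (meson finite_subset subgroup.subset)
  ultimately have "P <#> C = P" using cP by (metis card_seteq)
  moreover have "x \<in> P <#> C"
  proof -
    have "x = \<one> \<otimes> x" using x by simp
    thus ?thesis using subgroup.one_closed[OF sP] xC unfolding set_mult_def by blast
  qed
  ultimately show ?thesis by simp
qed

text \<open>The terms of the lower central series normalize \<open>P\<close>, as one sees by going up the series
  from its trivial end. If \<open>g\<close> lies in one term and \<open>h \<in> P\<close>, the conjugate of \<open>h\<close> by \<open>g\<close>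
  is the product of the commutator of \<open>g\<close> and \<open>h\<close>, which lies in the next term and so
  normalizes \<open>P\<close>, with \<open>h\<close>. The conjugate is then a \<open>p\<close>-element that normalizes \<open>P\<close>,
  hence it lies in \<open>P\<close>.\<close>

lemma nilpotent_sylow_normal:
  assumes nil: "nilpotent_group G" and fin: "finite (carrier G)" and p: "Factorial_Ring.prime p"
    and P: "sylow_subgroup p G P"
  shows "P \<lhd> G"
proof -
  have sP: "subgroup P G" and cP: "card P = p ^ multiplicity p (order G)"
    using P by (auto simp: sylow_subgroup_def)
  note Pc = subgroup.mem_carrier[OF sP]
  obtain n where n: "lower_central_series G n = {\<one>}"
    using nil by (auto simp: nilpotent_group_def)
  have "\<forall>g\<in>lower_central_series G k. \<forall>h\<in>P. g \<otimes> h \<otimes> inv g \<in> P" if "k \<le> n" for k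
    using that
  proof (induction k rule: inc_induct)
    case base show ?case using n Pc by simp
  next
    case (step k)
    show ?case
    proof (intro ballI)
      fix g h assume g: "g \<in> lower_central_series G k" and h: "h \<in> P"
      have gG: "g \<in> carrier G"
        using g lower_central_series_normal normal_imp_subgroup subgroup.mem_carrier by metis
      define y where "y = g \<otimes> h \<otimes> inv g"
      define c where "c = gcomm G g h"
      have yc: "y = c \<otimes> h" using gG h Pc by (simp add: y_def c_def gcomm_def m_assoc)
      have c: "c \<in> lower_central_series G (Suc k)" "c \<in> carrier G"
        using lower_central_series_gcomm[OF g] h Pc gG by (auto simp: c_def simp del: lower_central_series.simps)
      have "y [^] (p ^ multiplicity p (order G)) = g \<otimes> h [^] (p ^ multiplicity p (order G)) \<otimes> inv g"
      proof -
        have "(g \<otimes> h \<otimes> inv g) [^] j = g \<otimes> h [^] j \<otimes> inv g" for j :: nat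
        proof (induction j)
          case (Suc j)
          have "inv g \<otimes> (g \<otimes> a) = a" if "a \<in> carrier G" for a
            using that gG by (simp add: m_assoc[symmetric])
          thus ?case using Suc gG h Pc by (simp add: m_assoc)
        qed (use gG in simp)
        thus ?thesis by (simp add: y_def)
      qed
      also have "h [^] (p ^ multiplicity p (order G)) = \<one>"
      proof -
        interpret P: group "G\<lparr>carrier := P\<rparr>" using sP subgroup_imp_group by blast
        show ?thesis using P.pow_order_eq_1[of h] h cP by (simp add: order_def nat_pow_consistent[symmetric])
      qed
      finally have yp: "y [^] (p ^ multiplicity p (order G)) = \<one>" using gG by simp
      have "y \<otimes> h' \<otimes> inv y \<in> P" if h': "h' \<in> P" for h'
      proof -
        have "y \<otimes> h' \<otimes> inv y = c \<otimes> (h \<otimes> h' \<otimes> inv h) \<otimes> inv c"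
          using yc c h h' Pc by (simp add: m_assoc inv_mult_group)
        moreover have "h \<otimes> h' \<otimes> inv h \<in> P"
          using h h' sP by (meson subgroup.m_closed subgroup.m_inv_closed)
        ultimately show ?thesis using step.IH c by simp
      qed
      thus "g \<otimes> h \<otimes> inv g \<in> P"
        using sylow_contains_normalizing_p_element[OF fin p P _ yp] gG h Pc by (simp add: y_def)
    qed
  qed
  from this[of 0] show ?thesis using normal_invI[OF sP] by simp
qed

lemma nilpotent_sylow_contains_p_elements:
  assumes "nilpotent_group G" "finite (carrier G)" "Factorial_Ring.prime p" "sylow_subgroup p G P"
    and "x \<in> carrier G" "x [^] (p ^ k) = \<one>"
  shows "x \<in> P"
  using sylow_contains_normalizing_p_element[OF assms(2,3,4,5,6)] nilpotent_sylow_normal[OF assms(1-4)]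
    assms(5) normal_invE(2) by blast

text \<open>Normal Sylow subgroups for different primes can be multiplied one after the other;
  coprimality of the orders makes each of these products direct.\<close>

lemma nilpotent_hall_exists:
  assumes nil: "nilpotent_group G" and fin: "finite (carrier G)"
    and S: "finite S" "\<And>q. q \<in> S \<Longrightarrow> Factorial_Ring.prime q"
  shows "\<exists>Q. Q \<lhd> G \<and> card Q = (\<Prod>q\<in>S. q ^ multiplicity q (order G))"
  using S
proof (induction S rule: finite_induct)
  case empty show ?case using one_is_normal by force
next
  case (insert q S)
  then obtain Q where Q: "Q \<lhd> G" "card Q = (\<Prod>q\<in>S. q ^ multiplicity q (order G))" by auto
  have pr: "Factorial_Ring.prime q" using insert by simp
  have n0: "order G \<noteq> 0" using fin order_gt_0_iff_finite by simp
  have "order G = q ^ multiplicity q (order G) * (order G div q ^ multiplicity q (order G))"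
    by (simp add: multiplicity_dvd)
  then obtain P where P: "subgroup P G" "card P = q ^ multiplicity q (order G)"
    using sylow_thm[OF pr is_group _ fin] by metis
  hence PG: "P \<lhd> G" using nilpotent_sylow_normal[OF nil fin pr] by (auto simp: sylow_subgroup_def)
  have sQ: "subgroup Q G" using Q normal_imp_subgroup by blast
  have cop: "coprime (card Q) (card P)"
    unfolding Q(2) P(2)
    by (intro prod_coprime_left) (use insert in \<open>auto intro!: coprime_power_left_iff[THEN iffD2] coprime_power_right_iff[THEN iffD2] primes_coprime\<close>)
  have "card (Q \<inter> P) = 1"
  proof -
    have "subgroup (Q \<inter> P) G" using sQ P subgroup_Int by blast
    hence "card (Q \<inter> P) dvd card Q" "card (Q \<inter> P) dvd card P"
      using card_subgroup_dvd[of "Q \<inter> P"] sQ P(1) by blast+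
    thus ?thesis using cop by (metis coprime_common_divisor_nat)
  qed
  hence "card (Q <#> P) = card Q * card P" using card_set_mult_subgroups[OF sQ P(1) fin] by simp
  moreover have "Q <#> P \<lhd> G" using Q PG normal_subgroup_set_mult_closed by blast
  ultimately show ?case using insert Q P by (auto simp: mult.commute)
qed

text \<open>The complement is the Hall subgroup for all other prime divisors of the group order.\<close>

lemma nilpotent_sylow_complement:
  assumes nil: "nilpotent_group G" and fin: "finite (carrier G)" and p: "Factorial_Ring.prime p"
    and P: "sylow_subgroup p G P"
  obtains Q where "Q \<lhd> G" "P \<inter> Q = {\<one>}" "P <#> Q = carrier G"
proof -
  have sP: "subgroup P G" and cP: "card P = p ^ multiplicity p (order G)"
    using P by (auto simp: sylow_subgroup_def)
  have n0: "order G \<noteq> 0" using fin order_gt_0_iff_finite by simp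
  define S where "S = prime_factors (order G) - {p}"
  obtain Q where Q: "Q \<lhd> G" "card Q = (\<Prod>q\<in>S. q ^ multiplicity q (order G))"
    using nilpotent_hall_exists[OF nil fin, of S] by (auto simp: S_def)
  have sQ: "subgroup Q G" using Q normal_imp_subgroup by blast
  have cop: "coprime (card P) (card Q)"
    unfolding cP Q(2)
    by (intro prod_coprime_right) (use p in \<open>auto simp: S_def intro!: coprime_power_left_iff[THEN iffD2] coprime_power_right_iff[THEN iffD2] primes_coprime\<close>)
  have sI: "subgroup (P \<inter> Q) G" using sQ sP subgroup_Int by blast
  have c1: "card (P \<inter> Q) = 1"
  proof -
    have "card (P \<inter> Q) dvd card Q" "card (P \<inter> Q) dvd card P"
      using card_subgroup_dvd[OF sI] sQ sP by blast+
    thus ?thesis using cop by (metis coprime_common_divisor_nat)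
  qed
  hence I: "P \<inter> Q = {\<one>}"
    using subgroup.one_closed[OF sI] by (metis card_1_singletonE singletonD)
  have "order G = (\<Prod>q\<in>prime_factors (order G). q ^ multiplicity q (order G))"
    using prime_factorization_nat[of "order G"] n0 by simp
  also have "\<dots> = (\<Prod>q\<in>insert p S. q ^ multiplicity q (order G))"
  proof (rule prod.mono_neutral_left)
    show "\<forall>q\<in>insert p S - prime_factors (order G). q ^ multiplicity q (order G) = 1"
    proof
      fix q assume "q \<in> insert p S - prime_factors (order G)"
      hence "q = p" "\<not> p dvd order G" using n0 p by (auto simp: S_def prime_factors_dvd)
      thus "q ^ multiplicity q (order G) = 1" by (simp add: not_dvd_imp_multiplicity_0)
    qed
  qed (auto simp: S_def)
  also have "\<dots> = card P * card Q" 
  proof -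
    have "p \<notin> S" "finite S" by (auto simp: S_def)
    thus ?thesis by (simp add: Q(2) cP)
  qed
  also have "\<dots> = card (P <#> Q)" using card_set_mult_subgroups[OF sP sQ fin] c1 by simp
  finally have "card (P <#> Q) = card (carrier G)" by (simp add: order_def)
  moreover have "P <#> Q \<subseteq> carrier G"
    using setmult_subset_G sP sQ subgroup.subset by metis
  ultimately have "P <#> Q = carrier G" using card_subset_eq fin by blast
  thus ?thesis using that Q I by blast
qed

lemma normal_disjoint_commute:
  assumes "M \<lhd> G" "N \<lhd> G" "M \<inter> N = {\<one>}" "x \<in> M" "y \<in> N"
  shows "x \<otimes> y = y \<otimes> x"
proof -
  have s: "subgroup M G" "subgroup N G" using assms normal_imp_subgroup by auto
  have c: "x \<in> carrier G" "y \<in> carrier G" using s assms subgroup.mem_carrier by metis+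
  have "gcomm G x y = x \<otimes> (y \<otimes> inv x \<otimes> inv y)" using c by (simp add: gcomm_def m_assoc)
  also have "\<dots> \<in> M"
    using assms s c by (meson normal_invE(2) subgroup.m_closed subgroup.m_inv_closed)
  finally have 1: "gcomm G x y \<in> M" .
  have "gcomm G x y = (x \<otimes> y \<otimes> inv x) \<otimes> inv y" by (simp add: gcomm_def)
  also have "\<dots> \<in> N"
    using assms s c by (meson normal_invE(2) subgroup.m_closed subgroup.m_inv_closed)
  finally have "gcomm G x y = \<one>" using 1 assms(3) by blast
  thus ?thesis using gcomm_eq_one_iff c by blast
qed

text \<open>The complement of the Sylow subgroup centralizes it, so being central in the Sylow
  subgroup is enough for being central in the whole group.\<close>

lemma nilpotent_sylow_center:
  assumes nil: "nilpotent_group G" and fin: "finite (carrier G)" and p: "Factorial_Ring.prime p"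
    and P: "sylow_subgroup p G P"
  shows "center (G\<lparr>carrier := P\<rparr>) = center G \<inter> P"
proof
  have sP: "subgroup P G" using P by (simp add: sylow_subgroup_def)
  note Pc = subgroup.mem_carrier[OF sP]
  show "center G \<inter> P \<subseteq> center (G\<lparr>carrier := P\<rparr>)" using Pc by (auto simp: center_def)
  show "center (G\<lparr>carrier := P\<rparr>) \<subseteq> center G \<inter> P"
  proof
    fix z assume "z \<in> center (G\<lparr>carrier := P\<rparr>)"
    hence z: "z \<in> P" "\<And>x. x \<in> P \<Longrightarrow> x \<otimes> z = z \<otimes> x" by (auto simp: center_def)
    obtain Q where Q: "Q \<lhd> G" "P \<inter> Q = {\<one>}" "P <#> Q = carrier G"
      using nilpotent_sylow_complement[OF assms] by blast
    have Qc: "\<And>q. q \<in> Q \<Longrightarrow> q \<in> carrier G" using Q normal_imp_subgroup subgroup.mem_carrier by metis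
    have "g \<otimes> z = z \<otimes> g" if "g \<in> carrier G" for g
    proof -
      obtain x y where xy: "x \<in> P" "y \<in> Q" "g = x \<otimes> y"
        using \<open>g \<in> carrier G\<close> unfolding Q(3)[symmetric] by (auto simp: set_mult_def)
      have "z \<otimes> y = y \<otimes> z"
        using normal_disjoint_commute[OF nilpotent_sylow_normal[OF assms] Q(1,2) z(1) xy(2)] .
      moreover have "x \<otimes> z = z \<otimes> x" using z xy by blast
      ultimately show ?thesis using xy z(1) Pc Qc by (metis m_assoc)
    qed
    thus "z \<in> center G \<inter> P" using z(1) Pc by (auto simp: center_def)
  qed
qed

text \<open>Multiplication with the complement of \<open>P\<close> enlarges a subgroup of \<open>P\<close> to one of the whole
  group without changing its index or its intersection with \<open>P\<close>. The index equation is
  stated as an equation between products to avoid division.\<close>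

lemma nilpotent_sylow_subgroup_extends:
  assumes nil: "nilpotent_group G" and fin: "finite (carrier G)" and p: "Factorial_Ring.prime p"
    and P: "sylow_subgroup p G P" and W: "subgroup W G" "W \<subseteq> P"
  obtains Y where "subgroup Y G" "Y \<inter> P = W" "card Y * card P = card W * order G"
proof -
  have sP: "subgroup P G" using P by (simp add: sylow_subgroup_def)
  note Pc = subgroup.mem_carrier[OF sP]
  obtain Q where Q: "Q \<lhd> G" "P \<inter> Q = {\<one>}" "P <#> Q = carrier G"
    using nilpotent_sylow_complement[OF assms(1-4)] by blast
  have sQ: "subgroup Q G" using Q normal_imp_subgroup by blast
  note Qc = subgroup.mem_carrier[OF sQ]
  have WQ: "W \<inter> Q = {\<one>}" using W Q(2) subgroup.one_closed[OF W(1)] subgroup.one_closed[OF sQ] by auto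
  have "subgroup (W <#> Q) G"
    using mult_norm_subgroup[OF Q(1) W(1)] commut_normal[OF W(1) Q(1)] by simp
  moreover have "(W <#> Q) \<inter> P = W"
  proof
    show "W \<subseteq> (W <#> Q) \<inter> P"
    proof
      fix h assume "h \<in> W"
      hence "h \<in> P" "h = h \<otimes> \<one>" using W Pc by auto
      thus "h \<in> (W <#> Q) \<inter> P"
        using subgroup.one_closed[OF sQ] \<open>h \<in> W\<close> unfolding set_mult_def by blast
    qed
    show "(W <#> Q) \<inter> P \<subseteq> W"
    proof
      fix g assume "g \<in> (W <#> Q) \<inter> P"
      then obtain x q where g: "g \<in> P" "x \<in> W" "q \<in> Q" "g = x \<otimes> q" by (auto simp: set_mult_def)
      have xP: "x \<in> P" using g W by blast
      have "q = inv x \<otimes> g" using g xP Pc Qc by (simp add: m_assoc[symmetric])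
      hence "q \<in> P" using g(1) xP sP by (simp add: subgroup.m_closed subgroup.m_inv_closed)
      hence "q = \<one>" using Q g by blast
      thus "g \<in> W" using g xP Pc by simp
    qed
  qed
  moreover have "card (W <#> Q) * card P = card W * order G"
  proof -
    have "card W * card Q = card (W <#> Q)" "card P * card Q = order G"
      using card_set_mult_subgroups[OF W(1) sQ fin] card_set_mult_subgroups[OF sP sQ fin] WQ Q
      by (simp_all add: order_def)
    thus ?thesis by (metis mult.assoc mult.commute)
  qed
  ultimately show ?thesis using that by blast
qed

end

section \<open>Elements of prime order outside the centre\<close>

lemma odd_dvd_power_choose_two:
  fixes p :: nat
  assumes "odd p"
  shows "p dvd (p ^ k choose 2)"
proof (cases k)
  case (Suc j)
  have "even (p ^ k - 1)" using assms by simp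
  then obtain m where "p ^ k - 1 = 2 * m" by blast
  hence "p ^ k choose 2 = p ^ k * m" by (simp add: choose_two)
  thus ?thesis using Suc by simp
qed (simp add: numeral_2_eq_2)

lemma prime_dvd_affine_solvable:
  fixes p i j :: nat
  assumes "Factorial_Ring.prime p" "\<not> p dvd i"
  obtains t where "p dvd i * t + j"
proof -
  have "coprime i p" using assms prime_imp_coprime coprime_commute by metis
  hence "coprime (int i) (int p)" by simp
  then obtain x y where xy: "x * int i + y * int p = 1" using bezout_int by (metis coprime_iff_gcd_eq_1)
  define t where "t = nat ((- int j * x) mod int p)"
  have t: "int t = (- int j * x) mod int p"
    using prime_gt_0_nat[OF assms(1)] by (simp add: t_def)
  have "(int i * int t + int j) mod int p = (int i * (- int j * x) + int j) mod int p"
    unfolding t by (metis mod_add_left_eq mod_mult_right_eq)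
  also have "int i * (- int j * x) + int j = int p * (y * int j)"
    using arg_cong[OF xy, of "\<lambda>z. int j * z"] by (simp add: algebra_simps)
  finally have "int p dvd int (i * t + j)" by (simp add: mod_eq_0_iff_dvd)
  thus ?thesis using that by (simp only: int_dvd_int_iff)
qed

context group
begin

lemma skew_commute_pow:
  assumes c: "u \<in> carrier G" "v \<in> carrier G" "c \<in> carrier G"
    and uv: "u \<otimes> v = c \<otimes> (v \<otimes> u)" and cu: "c \<otimes> u = u \<otimes> c"
  shows "u [^] (n::nat) \<otimes> v = c [^] n \<otimes> (v \<otimes> u [^] n)"
proof (induction n)
  case 0 thus ?case using c by simp
next
  case (Suc n)
  have "u [^] Suc n \<otimes> v = u [^] n \<otimes> (c \<otimes> (v \<otimes> u))" using c uv by (simp add: m_assoc)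
  also have "\<dots> = c \<otimes> (u [^] n \<otimes> v) \<otimes> u"
  proof -
    have "u [^] n \<otimes> c = c \<otimes> u [^] n" using cu c by (metis group_commutes_pow)
    hence "u [^] n \<otimes> (c \<otimes> (v \<otimes> u)) = c \<otimes> u [^] n \<otimes> (v \<otimes> u)" using c by (simp add: m_assoc[symmetric])
    thus ?thesis using c by (simp add: m_assoc)
  qed
  also have "\<dots> = (c \<otimes> c [^] n) \<otimes> (v \<otimes> (u [^] n \<otimes> u))" using Suc c by (simp add: m_assoc)
  also have "c \<otimes> c [^] n = c [^] Suc n" using c by (metis nat_pow_Suc2)
  finally show ?case by simp
qed

text \<open>Collection in a group of class two: moving the factors \<open>u\<close> to the right past the factors
  \<open>v\<close> produces one \<open>c\<close> for each of the pairs that are exchanged.\<close>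

lemma skew_commute_mult_pow:
  assumes c: "u \<in> carrier G" "v \<in> carrier G" "c \<in> carrier G"
    and uv: "u \<otimes> v = c \<otimes> (v \<otimes> u)" and cu: "c \<otimes> u = u \<otimes> c" and cv: "c \<otimes> v = v \<otimes> c"
  shows "(v \<otimes> u) [^] (n::nat) = c [^] (n choose 2) \<otimes> (v [^] n \<otimes> u [^] n)"
proof (induction n)
  case 0 thus ?case using c by (simp add: numeral_2_eq_2)
next
  case (Suc n)
  have k: "v [^] n \<otimes> c [^] n = c [^] n \<otimes> v [^] n"
    using cv c by (metis group_commutes_pow nat_pow_closed)
  have "(v \<otimes> u) [^] Suc n = c [^] (n choose 2) \<otimes> (v [^] n \<otimes> (u [^] n \<otimes> v) \<otimes> u)"
    using Suc c by (simp add: m_assoc)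
  also have "\<dots> = c [^] (n choose 2) \<otimes> ((v [^] n \<otimes> c [^] n) \<otimes> v \<otimes> u [^] n \<otimes> u)"
    using c by (simp add: skew_commute_pow[OF c uv cu] m_assoc)
  also have "\<dots> = (c [^] (n choose 2) \<otimes> c [^] n) \<otimes> (v [^] Suc n \<otimes> u [^] Suc n)"
    unfolding k using c by (simp add: m_assoc)
  also have "c [^] (n choose 2) \<otimes> c [^] n = c [^] (Suc n choose 2)"
    using c by (simp add: nat_pow_mult numeral_2_eq_2 add.commute)
  finally show ?case .
qed

lemma p_power_of_order_p:
  fixes p :: nat
  assumes "x \<in> carrier G" "x \<noteq> \<one>" "x [^] (p ^ k) = \<one>"
  obtains j where "x [^] (p ^ j) \<noteq> \<one>" "(x [^] (p ^ j)) [^] p = \<one>"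
proof -
  obtain m where m: "x [^] (p ^ m) = \<one>" "\<And>j. j < m \<Longrightarrow> x [^] (p ^ j) \<noteq> \<one>"
    using assms(3) exists_least_iff[of "\<lambda>k. x [^] (p ^ k) = \<one>"] by blast
  obtain j where "m = Suc j" using m(1) assms by (cases m) auto
  thus ?thesis using that[of j] m assms(1) by (simp add: nat_pow_pow mult.commute)
qed

text \<open>Infinite descent on the orders of \<open>u\<close> and \<open>v\<close>. If the cyclic group of \<open>w\<close> contains all
  elements of order \<open>p\<close>, then the last nontrivial \<open>p\<close>-powers of \<open>u\<close> and \<open>v\<close> are powers
  of each other, so the element of smaller order can be multiplied with a power of the
  other one such that its order drops while its commutator remains \<open>c\<close>. The exponent of
  \<open>c\<close> in the collection formula is then a multiple of \<open>p\<close>, which is where \<open>p\<close> has to be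
  odd: a quaternion group contains such a pair for \<open>p = 2\<close>.\<close>

lemma no_skew_commuting_pair:
  fixes p :: nat
  assumes p: "Factorial_Ring.prime p" "odd p"
    and w: "w \<in> carrier G" "w [^] p = \<one>"
    and ord_p: "\<And>x. x \<in> carrier G \<Longrightarrow> x [^] p = \<one> \<Longrightarrow> \<exists>k::nat. x = w [^] k"
    and c: "u \<in> carrier G" "v \<in> carrier G" "c \<in> carrier G"
    and uv: "u \<otimes> v = c \<otimes> (v \<otimes> u)" and cu: "c \<otimes> u = u \<otimes> c" and cv: "c \<otimes> v = v \<otimes> c"
    and cp: "c \<noteq> \<one>" "c [^] p = \<one>"
    and ex: "u [^] (p ^ a) = \<one>" "v [^] (p ^ b) = \<one>"
  shows False
  using c uv cu cv cp ex
proof (induction "a + b" arbitrary: a b u v c rule: less_induct)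
  case (less a b u v c)
  have main: False
    if le: "b \<le> a" and c: "u \<in> carrier G" "v \<in> carrier G" "c \<in> carrier G"
    and uv: "u \<otimes> v = c \<otimes> (v \<otimes> u)" and cu: "c \<otimes> u = u \<otimes> c" and cv: "c \<otimes> v = v \<otimes> c"
    and cp: "c \<noteq> \<one>" "c [^] p = \<one>"
    and ex: "u [^] (p ^ a) = \<one>" "v [^] (p ^ b) = \<one>"
    and IH: "\<And>a' b' u v c. \<lbrakk>a' + b' < a + b; u \<in> carrier G; v \<in> carrier G; c \<in> carrier G;
           u \<otimes> v = c \<otimes> (v \<otimes> u); c \<otimes> u = u \<otimes> c; c \<otimes> v = v \<otimes> c; c \<noteq> \<one>; c [^] p = \<one>;
           u [^] (p ^ a') = \<one>; v [^] (p ^ b') = \<one>\<rbrakk> \<Longrightarrow> False"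
    for a b u v c
  proof (cases b)
    case 0
    hence "v = \<one>" using ex c by simp
    hence "c = \<one>" using uv c by simp
    thus False using cp by simp
  next
    case (Suc b')
    then obtain a' where a: "a = Suc a'" using le by (cases a) auto
    define e where "e = u [^] (p ^ a')"
    have e: "e \<in> carrier G" "e [^] p = \<one>"
      using c ex(1) by (simp_all add: e_def a nat_pow_pow mult.commute)
    have f: "v [^] (p ^ b') \<in> carrier G" "(v [^] (p ^ b')) [^] p = \<one>"
      using c ex(2) by (simp_all add: Suc nat_pow_pow mult.commute)
    obtain i :: nat where i: "e = w [^] i" using ord_p e by blast
    obtain j :: nat where j: "v [^] (p ^ b') = w [^] j" using ord_p f by blast
    show False
    proof (cases "p dvd i")
      \<comment> \<open>Here the bound \<open>p ^ a\<close> on the order of \<open>u\<close> is not sharp and can be lowered.\<close>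
      case True
      then obtain m where "i = p * m" by blast
      hence "e = \<one>" using i w by (simp add: nat_pow_pow[symmetric])
      thus False using IH[of a' b u v c] c uv cu cv cp ex a by (simp add: e_def)
    next
      case False
      then obtain t where t: "p dvd i * t + j" using prime_dvd_affine_solvable[OF p(1)] by blast
      \<comment> \<open>The exponent is chosen such that the p^b'-th power of v' is trivial, where b =
        Suc b'.\<close>
      define s where "s = p ^ (a' - b') * t"
      define u' where "u' = u [^] s"
      define v' where "v' = v \<otimes> u'"
      have c': "u' \<in> carrier G" "v' \<in> carrier G" using c by (simp_all add: u'_def v'_def)
      have cu': "c \<otimes> u' = u' \<otimes> c" using cu c unfolding u'_def by (metis group_commutes_pow)
      have cs: "c [^] s \<in> carrier G" using c by simp
      have rel: "u' \<otimes> v = c [^] s \<otimes> (v \<otimes> u')"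
        unfolding u'_def by (rule skew_commute_pow[OF c uv cu])
      have csu: "c [^] s \<otimes> u' = u' \<otimes> c [^] s" "c [^] s \<otimes> v = v \<otimes> c [^] s"
        using cu' cv c c' by (metis group_commutes_pow)+
      have "v' [^] (p ^ b') = (c [^] s) [^] (p ^ b' choose 2) \<otimes> (v [^] (p ^ b') \<otimes> u' [^] (p ^ b'))"
        unfolding v'_def by (rule skew_commute_mult_pow[OF c'(1) c(2) cs rel csu])
      also have "(c [^] s) [^] (p ^ b' choose 2) = \<one>"
      proof -
        obtain m where "p ^ b' choose 2 = p * m"
          using odd_dvd_power_choose_two[OF p(2), of b'] by blast
        hence "(c [^] s) [^] (p ^ b' choose 2) = (c [^] p) [^] (s * m)"
          using c by (simp add: nat_pow_pow mult.commute mult.left_commute)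
        thus ?thesis using cp by simp
      qed
      also have "u' [^] (p ^ b') = e [^] t"
      proof -
        have eq: "p ^ (a' - b') * t * p ^ b' = p ^ a' * t"
          using le a Suc by (metis Suc_le_mono le_add_diff_inverse2 mult.assoc mult.commute power_add)
        show ?thesis using c by (simp add: u'_def s_def e_def nat_pow_pow eq)
      qed
      also have "v [^] (p ^ b') \<otimes> e [^] t = w [^] (i * t + j)"
        using w by (simp add: i j nat_pow_pow nat_pow_mult add.commute)
      also have "\<dots> = \<one>" using t w by (metis dvdE nat_pow_one nat_pow_pow)
      finally have "v' [^] (p ^ b') = \<one>" by simp
      moreover have "u \<otimes> v' = c \<otimes> (v' \<otimes> u)"
      proof -
        have "u' \<otimes> u = u \<otimes> u'" unfolding u'_def using c by (metis group_commutes_pow)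
        hence "v' \<otimes> u = (v \<otimes> u) \<otimes> u'" using c c' by (simp add: v'_def m_assoc)
        moreover have "u \<otimes> v' = c \<otimes> (v \<otimes> u) \<otimes> u'"
          using uv c c' by (simp add: v'_def m_assoc[symmetric])
        ultimately show ?thesis using c c' by (simp add: m_assoc)
      qed
      moreover have "c \<otimes> v' = v' \<otimes> c"
        using cu' cv c c' unfolding v'_def by (metis m_assoc)
      ultimately show False using IH[of a b' u v' c] c c' cu cp ex Suc by simp
    qed
  qed
  show False
  proof (cases "b \<le> a")
    case True
    show False by (rule main[OF True less.prems]) (rule less.hyps; assumption)
  next
    case False
    have c: "u \<in> carrier G" "v \<in> carrier G" "c \<in> carrier G" using less.prems by auto
    have r: "v \<otimes> u = inv c \<otimes> (u \<otimes> v)" using less.prems(4) c by (simp add: m_assoc[symmetric])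
    have k: "inv c \<otimes> u = u \<otimes> inv c" "inv c \<otimes> v = v \<otimes> inv c"
      using less.prems(5,6) c by (metis inv_closed inv_solve_left inv_solve_right m_assoc m_closed)+
    have ic: "inv c \<in> carrier G" "inv c \<noteq> \<one>" "inv c [^] p = \<one>"
      using less.prems(7,8) c by (auto simp: nat_pow_inv)
    show False
    proof (rule main[of a b v u "inv c", OF _ c(2,1) ic(1) r k(2,1) ic(2,3) less.prems(10,9)])
      show "a \<le> b" using False by simp
    qed (rule less.hyps; simp add: add.commute)
  qed
qed

text \<open>A nonabelian \<open>p\<close>-group contains a nontrivial central commutator, the end of a chain of
  iterated commutators. Replacing one of its two entries by a suitable \<open>p\<close>-power makes
  the commutator have order \<open>p\<close>. If all elements of order \<open>p\<close> were central, and hence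
  powers of \<open>w\<close>, this pair would contradict the descent above.\<close>

theorem p_group_noncentral_element_of_order_p:
  fixes p :: nat
  assumes nil: "nilpotent_group G" and p: "Factorial_Ring.prime p" "odd p"
    and pel: "\<And>x. x \<in> carrier G \<Longrightarrow> \<exists>k. x [^] (p ^ k) = \<one>"
    and nc: "\<not> comm_group G"
    and w: "w \<in> carrier G" "w [^] p = \<one>"
    and cen: "\<And>x. x \<in> center G \<Longrightarrow> x [^] p = \<one> \<Longrightarrow> \<exists>k::nat. x = w [^] k"
  obtains h where "h \<in> carrier G" "h [^] p = \<one>" "h \<notin> center G"
proof (rule ccontr)
  assume "\<not> thesis"
  hence "\<And>h. h \<in> carrier G \<Longrightarrow> h [^] p = \<one> \<Longrightarrow> h \<in> center G" using that by blast
  hence ord_p: "\<And>h. h \<in> carrier G \<Longrightarrow> h [^] p = \<one> \<Longrightarrow> \<exists>k::nat. h = w [^] k" using cen by blast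
  have "\<exists>x\<in>carrier G. x \<notin> center G"
  proof (rule ccontr)
    assume "\<not> ?thesis"
    hence "comm_group G" by (intro group_comm_groupI) (auto simp: center_def)
    thus False using nc by simp
  qed
  then obtain x where x: "x \<in> carrier G" "x \<notin> center G" by blast
  have x1: "x \<noteq> \<one>" using x by (auto simp: center_def)
  have "x \<notin> center G \<longrightarrow> (\<exists>u\<in>carrier G. \<exists>v\<in>carrier G. gcomm G u v \<noteq> \<one> \<and> gcomm G u v \<in> center G)"
    (is "_ \<longrightarrow> ?E")
  proof (rule nilpotent_gcomm_induct[OF nil x(1) x1])
    fix x assume x: "x \<in> carrier G" "x \<noteq> \<one>"
      and IH: "\<And>y. y \<in> carrier G \<Longrightarrow> gcomm G x y \<noteq> \<one> \<Longrightarrow> gcomm G x y \<notin> center G \<longrightarrow> ?E"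
    show "x \<notin> center G \<longrightarrow> ?E"
    proof
      assume "x \<notin> center G"
      then obtain y where y: "y \<in> carrier G" "gcomm G x y \<noteq> \<one>"
        using x by (auto simp: center_def gcomm_eq_one_iff)
      show ?E
      proof (cases "gcomm G x y \<in> center G")
        case True thus ?thesis using x y by blast
      next
        case False thus ?thesis using IH y by blast
      qed
    qed
  qed
  then obtain u v where uv: "u \<in> carrier G" "v \<in> carrier G" "gcomm G u v \<noteq> \<one>" "gcomm G u v \<in> center G"
    using x by blast
  define d where "d = gcomm G u v"
  have d: "d \<in> carrier G" "d \<noteq> \<one>" "d \<otimes> u = u \<otimes> d" "d \<otimes> v = v \<otimes> d"
    using uv by (auto simp: d_def center_def)
  obtain k where "d [^] (p ^ k) = \<one>" using pel[OF d(1)] by blast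
  then obtain j where j: "d [^] (p ^ j) \<noteq> \<one>" "(d [^] (p ^ j)) [^] p = \<one>"
    using p_power_of_order_p[OF d(1,2)] by blast
  define c where "c = d [^] (p ^ j)"
  define u' where "u' = u [^] (p ^ j)"
  have cc: "u' \<in> carrier G" "v \<in> carrier G" "c \<in> carrier G" using uv d by (simp_all add: c_def u'_def)
  have c1: "c \<noteq> \<one>" "c [^] p = \<one>"
    using j by (simp_all add: c_def)
  have "u' \<otimes> v = c \<otimes> (v \<otimes> u')"
    unfolding u'_def c_def
    by (rule skew_commute_pow[OF uv(1,2) d(1) gcomm_swap[OF uv(1,2), folded d_def] d(3)])
  moreover have "c \<otimes> u' = u' \<otimes> c"
    unfolding u'_def c_def using d uv by (metis group_commutes_pow nat_pow_closed)
  moreover have "c \<otimes> v = v \<otimes> c"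
    unfolding c_def using d uv by (metis group_commutes_pow)
  moreover obtain a where "u' [^] (p ^ a) = \<one>" using pel cc by blast
  moreover obtain b where "v [^] (p ^ b) = \<one>" using pel cc by blast
  ultimately show False
    using no_skew_commuting_pair[OF p w ord_p cc _ _ _ c1] by blast
qed

end

section \<open>Subgroups of a direct product that identify two central elements\<close>

lemma (in group) pow_coprime_invertible:
  fixes p :: nat
  assumes "Factorial_Ring.prime p" "\<not> p dvd k" "x \<in> carrier G" "x [^] p = \<one>"
  obtains t :: nat where "(x [^] (k::nat)) [^] t = x"
proof -
  \<comment> \<open>That is, \<open>k * t\<close> is congruent to \<open>1\<close> modulo \<open>p\<close>.\<close>
  obtain t where t: "p dvd k * t + (p - 1)" using prime_dvd_affine_solvable[OF assms(1,2)] .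
  have "x [^] (k * t + (p - 1)) = \<one>"
    using t assms by (metis dvdE nat_pow_one nat_pow_pow)
  moreover have "x \<otimes> x [^] (p - 1) = \<one>"
    using assms prime_gt_0_nat[OF assms(1)] by (metis Suc_diff_1 nat_pow_Suc2)
  ultimately have "x [^] (k * t) = x"
    using assms by (metis nat_pow_closed nat_pow_mult r_cancel)
  thus ?thesis using that assms by (simp add: nat_pow_pow)
qed

lemma subgroup_DirProd_slices:
  assumes "group A" "group B" "subgroup M (A \<times>\<times> B)"
  shows "subgroup (fst ` M) A" "subgroup (snd ` M) B"
    and "subgroup {a \<in> carrier A. (a, \<one>\<^bsub>B\<^esub>) \<in> M} A" "subgroup {b \<in> carrier B. (\<one>\<^bsub>A\<^esub>, b) \<in> M} B"
proof -
  interpret A: group A by fact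
  interpret B: group B by fact
  interpret AB: group "A \<times>\<times> B" using assms DirProd_group by blast
  interpret M: subgroup M "A \<times>\<times> B" by fact
  have sub: "M \<subseteq> carrier A \<times> carrier B" using M.subset by simp
  have mult: "(a \<otimes>\<^bsub>A\<^esub> a', b \<otimes>\<^bsub>B\<^esub> b') \<in> M" if "(a, b) \<in> M" "(a', b') \<in> M" for a a' b b'
    using M.m_closed[OF that] by simp
  have inv: "(inv\<^bsub>A\<^esub> a, inv\<^bsub>B\<^esub> b) \<in> M" if "(a, b) \<in> M" for a b
  proof -
    have "a \<in> carrier A" "b \<in> carrier B" using sub that by auto
    from inv_DirProd[OF assms(1,2) this] show ?thesis using M.m_inv_closed[OF that] by metis
  qed
  have one: "(\<one>\<^bsub>A\<^esub>, \<one>\<^bsub>B\<^esub>) \<in> M" using M.one_closed by simp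
  show "subgroup (fst ` M) A"
    by (rule A.subgroupI) (use sub mult inv one in \<open>force+\<close>)
  show "subgroup (snd ` M) B"
    by (rule B.subgroupI) (use sub mult inv one in \<open>force+\<close>)
  show "subgroup {a \<in> carrier A. (a, \<one>\<^bsub>B\<^esub>) \<in> M} A"
    by (rule A.subgroupI) (use mult[of _ "\<one>\<^bsub>B\<^esub>" _ "\<one>\<^bsub>B\<^esub>"] inv[of _ "\<one>\<^bsub>B\<^esub>"] one in auto)
  show "subgroup {b \<in> carrier B. (\<one>\<^bsub>A\<^esub>, b) \<in> M} B"
    by (rule B.subgroupI) (use mult[of "\<one>\<^bsub>A\<^esub>" _ "\<one>\<^bsub>A\<^esub>"] inv[of "\<one>\<^bsub>A\<^esub>"] one in auto)
qed

text \<open>The fibres of the second projection are cosets of its kernel.\<close>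

lemma card_subgroup_DirProd:
  assumes "group A" "group B" "subgroup M (A \<times>\<times> B)" "finite (carrier A)" "finite (carrier B)"
  shows "card M = card (snd ` M) * card {a \<in> carrier A. (a, \<one>\<^bsub>B\<^esub>) \<in> M}" (is "_ = _ * card ?W")
proof (rule card_eq_image_times_fibre)
  interpret A: group A by fact
  interpret B: group B by fact
  interpret AB: group "A \<times>\<times> B" using assms DirProd_group by blast
  interpret M: subgroup M "A \<times>\<times> B" by fact
  have sub: "M \<subseteq> carrier A \<times> carrier B" using M.subset by simp
  show "finite M" using sub assms finite_subset by blast
  fix b assume "b \<in> snd ` M"
  then obtain a where ab: "(a, b) \<in> M" by auto
  have c: "a \<in> carrier A" "b \<in> carrier B" using ab sub by auto
  have "bij_betw (\<lambda>w. (w \<otimes>\<^bsub>A\<^esub> a, b)) ?W {x \<in> M. snd x = b}"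
  proof (rule bij_betw_byWitness[where f' = "\<lambda>x. fst x \<otimes>\<^bsub>A\<^esub> inv\<^bsub>A\<^esub> a"])
    show "\<forall>w\<in>?W. fst (w \<otimes>\<^bsub>A\<^esub> a, b) \<otimes>\<^bsub>A\<^esub> inv\<^bsub>A\<^esub> a = w" using c by (simp add: A.m_assoc)
    show "\<forall>x\<in>{x \<in> M. snd x = b}. (fst x \<otimes>\<^bsub>A\<^esub> inv\<^bsub>A\<^esub> a \<otimes>\<^bsub>A\<^esub> a, b) = x"
      using c sub by (auto simp: A.m_assoc)
    show "(\<lambda>w. (w \<otimes>\<^bsub>A\<^esub> a, b)) ` ?W \<subseteq> {x \<in> M. snd x = b}"
      using M.m_closed[OF _ ab] c by force
    show "(\<lambda>x. fst x \<otimes>\<^bsub>A\<^esub> inv\<^bsub>A\<^esub> a) ` {x \<in> M. snd x = b} \<subseteq> ?W"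
      using M.m_closed[OF _ M.m_inv_closed[OF ab]] c sub assms by (force simp: inv_DirProd)
  qed
  thus "card {x \<in> M. snd x = b} = card ?W" using bij_betw_same_card by fastforce
qed

text \<open>The \<open>p\<close>-local heart of the argument, in the manner of Goursat. Write \<open>W\<close> for the slice
  \<open>{a. (a, 1) \<in> L}\<close>. If \<open>L\<close> does not project onto \<open>B\<close>, then the image of the projection
  has index at least \<open>p\<close>, and \<open>Y = W\<close> will do. Otherwise the slice \<open>{b. (1, b) \<in> L}\<close> is
  normal in \<open>B\<close> and does not contain \<open>w\<close>, so it is trivial, and \<open>L\<close> is the graph of a
  homomorphism with kernel \<open>W\<close> from a subgroup of \<open>A\<close> onto \<open>B\<close> that maps \<open>z\<close> to \<open>w\<close>. Now
  \<open>Y\<close> is the preimage of the subgroup generated by a noncentral element of order \<open>p\<close>,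
  which avoids \<open>w\<close>; it is \<open>p\<close> times as large as \<open>W\<close>.\<close>

lemma twisted_subgroup_index:
  fixes p :: nat
  assumes A: "group A" "finite (carrier A)" and B: "nilpotent_group B"
    and p: "Factorial_Ring.prime p" "odd p" and cB: "order B = p ^ n" and nc: "\<not> comm_group B"
    and w: "w \<in> center B" "w \<noteq> \<one>\<^bsub>B\<^esub>" "w [^]\<^bsub>B\<^esub> p = \<one>\<^bsub>B\<^esub>"
    and cen: "\<And>x. x \<in> center B \<Longrightarrow> x [^]\<^bsub>B\<^esub> p = \<one>\<^bsub>B\<^esub> \<Longrightarrow> \<exists>k::nat. x = w [^]\<^bsub>B\<^esub> k"
    and L: "subgroup L (A \<times>\<times> B)" and zw: "(z, w) \<in> L" and z1: "(z, \<one>\<^bsub>B\<^esub>) \<notin> L"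
  shows "\<exists>Y. subgroup Y A \<and> z \<notin> Y \<and> p * card L \<le> card Y * order B"
proof -
  have gB: "group B" using B by (simp add: nilpotent_group_def)
  interpret A: group A by fact
  interpret B: group B by fact
  interpret AB: group "A \<times>\<times> B" using A gB DirProd_group by blast
  interpret L: subgroup L "A \<times>\<times> B" by fact
  have fB: "finite (carrier B)"
    using cB prime_gt_0_nat[OF p(1)] order_def B.order_gt_0_iff_finite by simp
  have pel: "\<exists>k. x [^]\<^bsub>B\<^esub> (p ^ k) = \<one>\<^bsub>B\<^esub>" if "x \<in> carrier B" for x
    using B.pow_order_eq_1[OF that] cB by metis
  have wc: "w \<in> carrier B" using w by (simp add: center_def)
  have sub: "L \<subseteq> carrier A \<times> carrier B" using L.subset by simp
  have zc: "z \<in> carrier A" using zw sub by auto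
  define W where "W = {a \<in> carrier A. (a, \<one>\<^bsub>B\<^esub>) \<in> L}"
  have sW: "subgroup W A" unfolding W_def using subgroup_DirProd_slices(3)[OF A(1) gB L] .
  have cL: "card L = card (snd ` L) * card W"
    unfolding W_def using card_subgroup_DirProd[OF A(1) gB L A(2) fB] .
  have sS: "subgroup (snd ` L) B" using subgroup_DirProd_slices(2)[OF A(1) gB L] .
  show ?thesis
  proof (cases "snd ` L = carrier B")
    case False
    have "card (snd ` L) dvd p ^ n"
      using B.card_subgroup_dvd[OF sS B.subgroup_self] subgroup.subset[OF sS] cB by (simp add: order_def)
    then obtain m where m: "m \<le> n" "card (snd ` L) = p ^ m" using divides_primepow_nat p(1) by blast
    have "card (snd ` L) < p ^ n"
      using False subgroup.subset[OF sS] fB cB by (metis order_def psubsetI psubset_card_mono)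
    hence "m < n" using m by (metis nat_less_le)
    hence "p ^ Suc m \<le> p ^ n" using prime_ge_1_nat[OF p(1)] by (intro power_increasing) auto
    hence "p * card L \<le> card W * order B" using cL m cB by (simp add: mult.commute mult.left_commute)
    moreover have "z \<notin> W" using z1 by (simp add: W_def)
    ultimately show ?thesis using sW by blast
  next
    case True
    define D where "D = {b \<in> carrier B. (\<one>\<^bsub>A\<^esub>, b) \<in> L}"
    have sD: "subgroup D B" unfolding D_def using subgroup_DirProd_slices(4)[OF A(1) gB L] .
    have D1: "D = {\<one>\<^bsub>B\<^esub>}"
    proof (rule ccontr)
      assume ne: "D \<noteq> {\<one>\<^bsub>B\<^esub>}"
      have "D \<lhd> B"
      proof (rule B.normal_invI[OF sD])
        fix b h assume b: "b \<in> carrier B" and h: "h \<in> D"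
        then obtain a where ab: "(a, b) \<in> L" using True by force
        have "a \<in> carrier A" using ab sub by auto
        moreover have "(a, b) \<otimes>\<^bsub>A \<times>\<times> B\<^esub> (\<one>\<^bsub>A\<^esub>, h) \<otimes>\<^bsub>A \<times>\<times> B\<^esub> inv\<^bsub>A \<times>\<times> B\<^esub> (a, b) \<in> L"
          using ab h by (intro L.m_closed L.m_inv_closed) (auto simp: D_def)
        ultimately show "b \<otimes>\<^bsub>B\<^esub> h \<otimes>\<^bsub>B\<^esub> inv\<^bsub>B\<^esub> b \<in> D"
          using b h A gB by (simp add: D_def inv_DirProd)
      qed
      then obtain y where y: "y \<in> D" "y \<in> center B" "y \<noteq> \<one>\<^bsub>B\<^esub>"
        using B.nilpotent_normal_meets_center[OF B _ ne] by blast
      have yc: "y \<in> carrier B" using y by (simp add: center_def)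
      obtain k where "y [^]\<^bsub>B\<^esub> (p ^ k) = \<one>\<^bsub>B\<^esub>" using pel[OF yc] by blast
      then obtain j where j: "y [^]\<^bsub>B\<^esub> (p ^ j) \<noteq> \<one>\<^bsub>B\<^esub>" "(y [^]\<^bsub>B\<^esub> (p ^ j)) [^]\<^bsub>B\<^esub> p = \<one>\<^bsub>B\<^esub>"
        using B.p_power_of_order_p[OF yc y(3)] by blast
      \<comment> \<open>A suitable power of y is a central element of order p, so w is one of its
        powers.\<close>
      define d where "d = y [^]\<^bsub>B\<^esub> (p ^ j)"
      have dc: "d \<in> center B"
        using y(2) B.group_commutes_pow[of y _ "p ^ j"] by (auto simp: d_def center_def)
      have d: "d \<noteq> \<one>\<^bsub>B\<^esub>" "d [^]\<^bsub>B\<^esub> p = \<one>\<^bsub>B\<^esub>"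
        using j by (simp_all add: d_def)
      have powD: "x [^]\<^bsub>B\<^esub> (i::nat) \<in> D" if "x \<in> D" for x i
        using that subgroup.m_closed[OF sD] subgroup.one_closed[OF sD] by (induction i) auto
      obtain i :: nat where i: "d = w [^]\<^bsub>B\<^esub> i" using cen[OF dc d(2)] by blast
      have "\<not> p dvd i"
      proof
        assume "p dvd i"
        then obtain m where "i = p * m" by blast
        thus False using i w wc d by (simp add: B.nat_pow_pow[symmetric])
      qed
      then obtain t :: nat where "d [^]\<^bsub>B\<^esub> t = w" using B.pow_coprime_invertible[OF p(1) _ wc w(3)] i by metis
      hence "w \<in> D" using powD y(1) unfolding d_def by metis
      hence "(z, w) \<otimes>\<^bsub>A \<times>\<times> B\<^esub> inv\<^bsub>A \<times>\<times> B\<^esub> (\<one>\<^bsub>A\<^esub>, w) \<in> L"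
        using zw by (intro L.m_closed L.m_inv_closed) (auto simp: D_def)
      thus False using z1 zc wc A gB by (simp add: inv_DirProd)
    qed
    obtain h where h: "h \<in> carrier B" "h [^]\<^bsub>B\<^esub> p = \<one>\<^bsub>B\<^esub>" "h \<notin> center B"
      using B.p_group_noncentral_element_of_order_p[OF B p pel nc wc w(3) cen] by blast
    have h1: "h \<noteq> \<one>\<^bsub>B\<^esub>" using h by (auto simp: center_def)
    have oh: "B.ord h = p"
      using h h1 p(1) B.pow_eq_id[OF h(1)] B.ord_eq_1[OF h(1)] by (metis prime_nat_iff)
    define C where "C = generate B {h}"
    have C: "C = {h [^]\<^bsub>B\<^esub> k |k. k \<in> (UNIV :: nat set)}"
      unfolding C_def using B.generate_pow_on_finite_carrier[OF fB h(1)] .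
    have cC: "card C = p" using oh B.generate_pow_card[OF h(1)] by (simp add: C_def)
    have sC: "subgroup C B" unfolding C_def using B.generate_is_subgroup h by simp
    \<comment> \<open>The first projection is injective on M, and its image is the preimage of C.\<close>
    define M where "M = L \<inter> (carrier A \<times> C)"
    have sM: "subgroup M (A \<times>\<times> B)"
      unfolding M_def using subgroup_Int[OF L DirProd_subgroups[OF A(1) A.subgroup_self gB sC]] .
    have CB: "C \<subseteq> carrier B" using sC subgroup.subset by blast
    have sndM: "snd ` M = C"
    proof
      show "C \<subseteq> snd ` M"
      proof
        fix b assume b: "b \<in> C"
        then obtain a where "(a, b) \<in> L" using True CB by force
        thus "b \<in> snd ` M" using b sub by (force simp: M_def)
      qed
    qed (auto simp: M_def)
    have "{a \<in> carrier A. (a, \<one>\<^bsub>B\<^esub>) \<in> M} = W"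
      using subgroup.one_closed[OF sC] by (auto simp: M_def W_def)
    hence cM: "card M = p * card W"
      using card_subgroup_DirProd[OF A(1) gB sM A(2) fB] sndM cC by simp
    have "inj_on fst M"
    proof (rule inj_onI)
      fix x y assume x: "x \<in> M" and y: "y \<in> M" and e: "fst x = fst y"
      obtain a b b' where ab: "x = (a, b)" "y = (a, b')" using e by (metis prod.collapse)
      have L2: "(a, b) \<in> L" "(a, b') \<in> L" using x y ab by (auto simp: M_def)
      hence "(a, b) \<otimes>\<^bsub>A \<times>\<times> B\<^esub> inv\<^bsub>A \<times>\<times> B\<^esub> (a, b') \<in> L" by blast
      moreover have c: "a \<in> carrier A" "b \<in> carrier B" "b' \<in> carrier B" using L2 sub by auto
      ultimately have "b \<otimes>\<^bsub>B\<^esub> inv\<^bsub>B\<^esub> b' \<in> D" using A gB by (simp add: D_def inv_DirProd)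
      hence "b = b'" using D1 c B.inv_solve_right' by force
      thus "x = y" using ab by simp
    qed
    hence cY: "card (fst ` M) = p * card W" using cM card_image by metis
    have "z \<notin> fst ` M"
    proof
      assume "z \<in> fst ` M"
      then obtain b where b: "(z, b) \<in> L" "b \<in> C" by (auto simp: M_def)
      have bc: "b \<in> carrier B" using b CB by blast
      have "(z, b) \<otimes>\<^bsub>A \<times>\<times> B\<^esub> inv\<^bsub>A \<times>\<times> B\<^esub> (z, w) \<in> L" using b zw by blast
      hence "b \<otimes>\<^bsub>B\<^esub> inv\<^bsub>B\<^esub> w \<in> D" using A gB bc wc zc by (simp add: D_def inv_DirProd)
      hence "b = w" using D1 bc wc B.inv_solve_right' by force
      then obtain k :: nat where k: "w = h [^]\<^bsub>B\<^esub> k" using b C by blast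
      \<comment> \<open>If w were a power of h, then h would be a power of w and hence central.\<close>
      have "\<not> p dvd k"
      proof
        assume "p dvd k"
        then obtain m where "k = p * m" by blast
        thus False using k w h by (simp add: B.nat_pow_pow[symmetric])
      qed
      then obtain t :: nat where t: "w [^]\<^bsub>B\<^esub> t = h"
        using B.pow_coprime_invertible[OF p(1) _ h(1,2)] k by metis
      have "h \<in> center B"
        using w(1) B.group_commutes_pow[of w _ t] h(1) unfolding t[symmetric] center_def by auto
      thus False using h by blast
    qed
    moreover have "p * card L = card (fst ` M) * order B"
      using cY cL True by (simp add: order_def)
    ultimately show ?thesis using subgroup_DirProd_slices(1)[OF A(1) gB sM] by (metis order_refl)
  qed
qed

section \<open>Degrees of permutation representations\<close>

text \<open>The actions considered below are on disjoint unions of sets of points; relabelling these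
  points turns them into actions on an initial segment of the numbers.\<close>

lemma mon_sym_group_of_action:
  fixes f :: "'a \<Rightarrow> 'e \<Rightarrow> 'e"
  assumes "group G" "finite E"
    and perm: "\<And>x. x \<in> carrier G \<Longrightarrow> f x permutes E"
    and mult: "\<And>x y. x \<in> carrier G \<Longrightarrow> y \<in> carrier G \<Longrightarrow> f (x \<otimes>\<^bsub>G\<^esub> y) = f x \<circ> f y"
    and faithful: "\<And>x. x \<in> carrier G \<Longrightarrow> f x = id \<Longrightarrow> x = \<one>\<^bsub>G\<^esub>"
  shows "mon G (sym_group (card E)) \<noteq> {}"
proof -
  obtain g where g: "bij_betw g {1..card E} E"
    using ex_bij_betw_nat_finite_1[OF assms(2)] by blast
  define b where "b = inv_into {1..card E} g"
  have b: "bij_betw b E {1..card E}" unfolding b_def using bij_betw_inv_into[OF g] .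
  define F where "F = (\<lambda>x. map_permutation E b (f x))"
  have inj: "inj_on b E" using b bij_betw_def by blast
  have recover: "map_permutation {1..card E} (inv_into E b) (F x) = f x" if "x \<in> carrier G" for x
    unfolding F_def
    by (rule map_permutation_compose_inv[OF b perm[OF that]]) (use inj in simp)
  have "F \<in> hom G (sym_group (card E))"
  proof (rule homI)
    fix x assume "x \<in> carrier G"
    thus "F x \<in> carrier (sym_group (card E))"
      unfolding sym_group_carrier F_def using map_permutation_permutes[OF b perm] by blast
  qed (simp add: sym_group_mult F_def mult map_permutation_compose'[OF inj perm])
  moreover have "x = \<one>\<^bsub>G\<^esub>" if "x \<in> carrier G" "F x = id" for x
  proof (rule faithful[OF that(1)])
    have "f x = map_permutation {1..card E} (inv_into E b) id" using recover[OF that(1)] that(2) by simp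
    also have "\<dots> = id"
      by (rule map_permutation_id') (use bij_betw_inv_into[OF b] in \<open>simp add: bij_betw_def\<close>)
    finally show "f x = id" .
  qed
  ultimately have "F \<in> mon G (sym_group (card E))"
    using mon_iff_hom_one[OF assms(1) sym_group_is_group] by (auto simp: sym_group_one)
  thus ?thesis by blast
qed

lemma mu_le: "mon G (sym_group m) \<noteq> {} \<Longrightarrow> mu G \<le> m"
  unfolding mu_def by (rule Least_le)

lemma mon_sym_group_mu: "mon G (sym_group m) \<noteq> {} \<Longrightarrow> mon G (sym_group (mu G)) \<noteq> {}"
  unfolding mu_def by (rule LeastI)

text \<open>The disjoint union of the coset actions of a family of subgroups is faithful as soon as
  no nontrivial element has all its conjugates in all members of the family.\<close>

lemma (in group) mon_sym_group_of_subgroups: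
  assumes fin: "finite (carrier G)" "finite I"
    and sub: "\<And>i. i \<in> I \<Longrightarrow> subgroup (Y i) G"
    and core: "\<And>g. g \<in> carrier G \<Longrightarrow>
      (\<And>i x. i \<in> I \<Longrightarrow> x \<in> carrier G \<Longrightarrow> x \<otimes> g \<otimes> inv x \<in> Y i) \<Longrightarrow> g = \<one>"
  shows "mon G (sym_group (\<Sum>i\<in>I. card (rcosets (Y i)))) \<noteq> {}"
proof -
  define E where "E = (SIGMA i:I. rcosets (Y i))"
  \<comment> \<open>The inverse turns multiplication from the right into a left action.\<close>
  define f where "f = (\<lambda>g (i, C). if (i, C) \<in> E then (i, C #> inv g) else (i, C))"
  have YG: "Y i \<subseteq> carrier G" if "i \<in> I" for i using sub[OF that] subgroup.subset by blast
  have closed: "C #> g \<in> rcosets (Y i)" if "i \<in> I" "C \<in> rcosets (Y i)" "g \<in> carrier G" for i C g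
    using that YG by (auto simp: RCOSETS_def coset_mult_assoc)
  have CG: "C \<subseteq> carrier G" if "i \<in> I" "C \<in> rcosets (Y i)" for i C
    using that YG by (auto simp: RCOSETS_def r_coset_def)
  have finR: "finite (rcosets (Y i))" if "i \<in> I" for i
    using fin by (simp add: RCOSETS_def)
  have cE: "card E = (\<Sum>i\<in>I. card (rcosets (Y i)))"
    unfolding E_def using fin finR by (intro card_SigmaI) auto
  have fE: "finite E" unfolding E_def using fin finR by (intro finite_SigmaI) auto
  have perm: "f g permutes E" if g: "g \<in> carrier G" for g
  proof (rule bij_imp_permutes)
    show "bij_betw (f g) E E"
      by (rule bij_betw_byWitness[where f' = "f (inv g)"])
        (use g CG closed in \<open>auto simp: f_def E_def coset_mult_assoc\<close>)
    show "f g x = x" if "x \<notin> E" for x using that by (cases x) (auto simp: f_def)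
  qed
  have mult: "f (g \<otimes> h) = f g \<circ> f h" if "g \<in> carrier G" "h \<in> carrier G" for g h
    using that CG closed by (auto simp: f_def E_def fun_eq_iff coset_mult_assoc inv_mult_group)
  have "g = \<one>" if g: "g \<in> carrier G" "f g = id" for g
  proof -
    have "inv g = \<one>"
    proof (rule core)
      fix i x assume i: "i \<in> I" and x: "x \<in> carrier G"
      have E: "(i, Y i #> x) \<in> E" using i x by (auto simp: E_def RCOSETS_def)
      have "f g (i, Y i #> x) = (i, Y i #> x)" using g by simp
      hence "Y i #> x #> inv g = Y i #> x" using E by (simp add: f_def)
      hence "Y i #> (x \<otimes> inv g \<otimes> inv x) = Y i"
        using YG[OF i] x g by (metis coset_mult_assoc coset_mult_one inv_closed m_closed r_inv)
      thus "x \<otimes> inv g \<otimes> inv x \<in> Y i" using coset_join1 sub[OF i] x g by (metis inv_closed m_closed)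
    qed (use g in simp)
    thus ?thesis using g by simp
  qed
  hence "mon G (sym_group (card E)) \<noteq> {}"
    using mon_sym_group_of_action[of G E f, OF is_group fE perm mult] by blast
  thus ?thesis unfolding cE .
qed

lemma (in group) mon_sym_group_mu_finite:
  assumes "finite (carrier G)"
  shows "mon G (sym_group (mu G)) \<noteq> {}"
proof -
  have "mon G (sym_group (\<Sum>i\<in>{()}. card (rcosets {\<one>}))) \<noteq> {}"
  proof (rule mon_sym_group_of_subgroups[OF assms])
    fix g assume g: "g \<in> carrier G"
      and c: "\<And>(i::unit) x. i \<in> {()} \<Longrightarrow> x \<in> carrier G \<Longrightarrow> x \<otimes> g \<otimes> inv x \<in> {\<one>}"
    show "g = \<one>" using c[of "()" \<one>] g by simp
  qed (use triv_subgroup in auto)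
  thus ?thesis using mon_sym_group_mu by blast
qed

lemma map_sum_permutes:
  assumes p: "p permutes A" and q: "q permutes B"
  shows "map_sum p q permutes (Sum_Type.Plus A B)"
proof (rule bij_imp_permutes)
  show "bij_betw (map_sum p q) (Sum_Type.Plus A B) (Sum_Type.Plus A B)"
  proof (rule bij_betw_imageI)
    show "inj_on (map_sum p q) (Sum_Type.Plus A B)"
      using permutes_inj[OF p] permutes_inj[OF q] by (intro inj_onI) (auto dest: injD)
    have "map_sum p q ` (Sum_Type.Plus A B) = Sum_Type.Plus (p ` A) (q ` B)"
      by (auto simp: Plus_def image_Un image_image)
    thus "map_sum p q ` (Sum_Type.Plus A B) = Sum_Type.Plus A B"
      using permutes_image[OF p] permutes_image[OF q] by simp
  qed
  fix y assume "y \<notin> Sum_Type.Plus A B"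
  thus "map_sum p q y = y"
    using permutes_not_in[OF p] permutes_not_in[OF q] by (cases y) auto
qed

text \<open>The two factors act independently on the disjoint union of the sets on which they act
  faithfully.\<close>

lemma mu_DirProd_le:
  assumes "group G" "group H" "finite (carrier G)" "finite (carrier H)"
  shows "mu (G \<times>\<times> H) \<le> mu G + mu H"
proof -
  obtain \<rho> where \<rho>: "\<rho> \<in> mon G (sym_group (mu G))"
    using group.mon_sym_group_mu_finite assms by blast
  obtain \<sigma> where \<sigma>: "\<sigma> \<in> mon H (sym_group (mu H))"
    using group.mon_sym_group_mu_finite assms by blast
  have \<rho>h: "\<rho> \<in> hom G (sym_group (mu G))" and \<sigma>h: "\<sigma> \<in> hom H (sym_group (mu H))"
    using \<rho> \<sigma> by (auto simp: mon_def)
  have \<rho>p: "\<rho> g permutes {1..mu G}" if "g \<in> carrier G" for g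
    using hom_in_carrier[OF \<rho>h that] by (simp add: sym_group_carrier)
  have \<sigma>p: "\<sigma> h permutes {1..mu H}" if "h \<in> carrier H" for h
    using hom_in_carrier[OF \<sigma>h that] by (simp add: sym_group_carrier)
  have "mon (G \<times>\<times> H) (sym_group (card (Sum_Type.Plus {1..mu G} {1..mu H}))) \<noteq> {}"
  proof (rule mon_sym_group_of_action[where f = "\<lambda>(g, h). map_sum (\<rho> g) (\<sigma> h)"])
    show "group (G \<times>\<times> H)" using assms DirProd_group by blast
    show "finite (Sum_Type.Plus {1..mu G} {1..mu H})" by simp
    fix x assume "x \<in> carrier (G \<times>\<times> H)"
    then obtain g h where x: "x = (g, h)" "g \<in> carrier G" "h \<in> carrier H" by auto
    have "map_sum (\<rho> g) (\<sigma> h) permutes (Sum_Type.Plus {1..mu G} {1..mu H})"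
      using map_sum_permutes[OF \<rho>p[OF x(2)] \<sigma>p[OF x(3)]] .
    thus "(case x of (g, h) \<Rightarrow> map_sum (\<rho> g) (\<sigma> h)) permutes (Sum_Type.Plus {1..mu G} {1..mu H})" using x by simp
    show "x = \<one>\<^bsub>G \<times>\<times> H\<^esub>" if "(case x of (g, h) \<Rightarrow> map_sum (\<rho> g) (\<sigma> h)) = id"
    proof -
      have e: "map_sum (\<rho> g) (\<sigma> h) y = y" for y using that x by simp
      have "\<rho> g = id" "\<sigma> h = id" using e[of "Inl _"] e[of "Inr _"] by (auto simp: fun_eq_iff)
      thus ?thesis
        using \<rho> \<sigma> x mon_iff_hom_one[OF assms(1) sym_group_is_group] mon_iff_hom_one[OF assms(2) sym_group_is_group]
        by (simp add: sym_group_one)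
    qed
    fix y assume "y \<in> carrier (G \<times>\<times> H)"
    thus "(case x \<otimes>\<^bsub>G \<times>\<times> H\<^esub> y of (g, h) \<Rightarrow> map_sum (\<rho> g) (\<sigma> h)) =
        (case x of (g, h) \<Rightarrow> map_sum (\<rho> g) (\<sigma> h)) \<circ> (case y of (g, h) \<Rightarrow> map_sum (\<rho> g) (\<sigma> h))"
      using x hom_mult[OF \<rho>h] hom_mult[OF \<sigma>h] by (auto simp: sym_group_mult map_sum.comp)
  qed
  thus ?thesis using mu_le by (fastforce simp: card_Plus)
qed

lemma sum_le_prod_of_ge_two:
  fixes f :: "'i \<Rightarrow> nat"
  assumes "finite A" "\<And>x. x \<in> A \<Longrightarrow> 2 \<le> f x"
  shows "sum f A \<le> prod f A"
  using assms
proof (induction A rule: finite_induct)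
  case (insert a A)
  show ?case
  proof (cases "A = {}")
    case False
    then obtain b where b: "b \<in> A" by blast
    have "f b dvd prod f A" using b insert by auto
    moreover have "0 < f y" if "y \<in> A" for y using insert.prems[of y] that by simp
    hence "0 < prod f A" by (intro prod_pos) auto
    ultimately have "f b \<le> prod f A" by (rule dvd_imp_le)
    hence "2 \<le> prod f A" using insert.prems[of b] b by simp
    then obtain m where m: "prod f A = m + 2" by (metis le_add_diff_inverse2)
    obtain n where n: "f a = n + 2" using insert.prems[of a] by (metis insertI1 le_add_diff_inverse2)
    have "f a + prod f A \<le> f a * prod f A" unfolding m n by (simp add: algebra_simps)
    thus ?thesis using insert by fastforce
  qed (use insert in simp)
qed simp

lemma prod_dvd_of_coprime:
  fixes f :: "'i \<Rightarrow> nat"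
  assumes "finite A" "\<And>x. x \<in> A \<Longrightarrow> f x dvd n"
    and "\<And>x y. x \<in> A \<Longrightarrow> y \<in> A \<Longrightarrow> x \<noteq> y \<Longrightarrow> coprime (f x) (f y)"
  shows "prod f A dvd n"
  using assms
proof (induction A rule: finite_induct)
  case (insert a A)
  have "coprime (f a) (prod f A)" using insert by (intro prod_coprime_right) auto
  thus ?case using insert by (simp add: divides_mult)
qed simp

text \<open>For each \<open>i\<close> choose a point moved by \<open>t i\<close>. By hypothesis its orbit has a size divisible
  by a power of \<open>p i\<close> that is at least \<open>c i\<close>. When one orbit serves several indices,
  these powers are coprime and at least two, so the orbit is at least as large as their
  product, and hence as their sum. Orbits are disjoint.\<close>

lemma sum_index_bounds_le_degree:
  fixes p c :: "'i \<Rightarrow> nat"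
  assumes T: "group T" "finite (carrier T)" and \<rho>: "\<rho> \<in> hom T (sym_group m)"
    and I: "finite I" "inj_on p I" "\<And>i. i \<in> I \<Longrightarrow> Factorial_Ring.prime (p i)"
    and t: "\<And>i. i \<in> I \<Longrightarrow> t i \<in> carrier T" "\<And>i. i \<in> I \<Longrightarrow> \<rho> (t i) \<noteq> id"
    and c: "\<And>i. i \<in> I \<Longrightarrow> 2 \<le> c i"
    and index: "\<And>i L. i \<in> I \<Longrightarrow> subgroup L T \<Longrightarrow> (\<And>x. x \<in> carrier T \<Longrightarrow> \<rho> x = id \<Longrightarrow> x \<in> L) \<Longrightarrow>
      t i \<notin> L \<Longrightarrow> \<exists>k. c i \<le> p i ^ k \<and> p i ^ k * card L dvd order T"
  shows "(\<Sum>i\<in>I. c i) \<le> m"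
proof -
  interpret T: group T by fact
  define \<phi> where "\<phi> = (\<lambda>g. restrict (\<rho> g) {1..m})"
  have perm: "\<rho> g permutes {1..m}" if "g \<in> carrier T" for g
    using hom_in_carrier[OF \<rho> that] by (simp add: sym_group_carrier)
  have Bij: "\<phi> g \<in> Bij {1..m}" if "g \<in> carrier T" for g
    using permutes_imp_bij[OF perm[OF that]] by (simp add: \<phi>_def Bij_def)
  interpret group_action T "{1..m}" \<phi>
  proof (rule group_action.intro, rule group_hom.intro)
    show "group_hom_axioms T (BijGroup {1..m}) \<phi>"
    proof (unfold_locales, rule homI)
      fix g h assume g: "g \<in> carrier T" and h: "h \<in> carrier T"
      have "\<phi> (g \<otimes>\<^bsub>T\<^esub> h) = compose {1..m} (\<phi> g) (\<phi> h)"
        using hom_mult[OF \<rho> g h] permutes_in_image[OF perm[OF h]]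
        by (auto simp: \<phi>_def compose_def fun_eq_iff sym_group_mult)
      thus "\<phi> (g \<otimes>\<^bsub>T\<^esub> h) = \<phi> g \<otimes>\<^bsub>BijGroup {1..m}\<^esub> \<phi> h"
        using Bij[OF g] Bij[OF h] by (simp add: BijGroup_def)
    qed (use Bij in \<open>simp add: BijGroup_def\<close>)
  qed (use T group_BijGroup in auto)
  have "\<exists>x\<in>{1..m}. \<rho> (t i) x \<noteq> x" if "i \<in> I" for i
    using t[OF that] perm[of "t i"] by (metis id_apply ext permutes_not_in)
  then obtain x where x: "\<And>i. i \<in> I \<Longrightarrow> x i \<in> {1..m}" "\<And>i. i \<in> I \<Longrightarrow> \<rho> (t i) (x i) \<noteq> x i" by metis
  define orb where "orb = (\<lambda>i. orbit T \<phi> (x i))"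
  have "\<exists>k. c i \<le> p i ^ k \<and> p i ^ k dvd card (orb i)" if i: "i \<in> I" for i
  proof -
    let ?L = "stabilizer T \<phi> (x i)"
    have L: "subgroup ?L T" using stabilizer_subgroup x(1)[OF i] by blast
    have "t i \<notin> ?L" using x[OF i] by (simp add: stabilizer_def \<phi>_def)
    moreover have "y \<in> ?L" if "y \<in> carrier T" "\<rho> y = id" for y
      using that x[OF i] by (simp add: stabilizer_def \<phi>_def)
    ultimately obtain k where k: "c i \<le> p i ^ k" "p i ^ k * card ?L dvd order T"
      using index[OF i L] by blast
    have "p i ^ k * card ?L dvd card (orb i) * card ?L"
      using k orbit_stabilizer_theorem[OF x(1)[OF i]] by (simp add: orb_def)
    hence "p i ^ k dvd card (orb i)" using T.card_subgroup_pos[OF T(2) L] by simp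
    thus ?thesis using k by blast
  qed
  then obtain k where k: "\<And>i. i \<in> I \<Longrightarrow> c i \<le> p i ^ k i" "\<And>i. i \<in> I \<Longrightarrow> p i ^ k i dvd card (orb i)"
    by metis
  have orbs: "orb ` I \<subseteq> orbits T {1..m} \<phi>" using x by (auto simp: orb_def orbits_def)
  have sub: "U \<subseteq> {1..m}" if "U \<in> orb ` I" for U using that orbs orbits_coverture by blast
  have fibre: "(\<Sum>i\<in>{i \<in> I. orb i = U}. c i) \<le> card U" if U: "U \<in> orb ` I" for U
  proof -
    have "(\<Sum>i\<in>{i \<in> I. orb i = U}. c i) \<le> (\<Sum>i\<in>{i \<in> I. orb i = U}. p i ^ k i)"
      using k by (intro sum_mono) auto
    also have "\<dots> \<le> (\<Prod>i\<in>{i \<in> I. orb i = U}. p i ^ k i)"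
      using I(1) by (intro sum_le_prod_of_ge_two) (use c k in \<open>auto intro: le_trans\<close>)
    also have "\<dots> \<le> card U"
    proof (rule dvd_imp_le)
      show "(\<Prod>i\<in>{i \<in> I. orb i = U}. p i ^ k i) dvd card U"
        by (rule prod_dvd_of_coprime)
          (use I k in \<open>auto intro!: coprime_power_left_iff[THEN iffD2] coprime_power_right_iff[THEN iffD2] primes_coprime dest: inj_onD\<close>)
      obtain i where i: "i \<in> I" "U = orb i" using U by blast
      have "x i \<in> U" using orbit_refl x(1)[OF i(1)] i by (simp add: orb_def)
      thus "0 < card U" using sub[OF U] by (metis card_gt_0_iff empty_iff finite_atLeastAtMost finite_subset)
    qed
    finally show ?thesis .
  qed
  have "(\<Sum>i\<in>I. c i) = (\<Sum>U\<in>orb ` I. \<Sum>i\<in>{i \<in> I. orb i = U}. c i)"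
    using sum.image_gen[OF I(1)] by blast
  also have "\<dots> \<le> (\<Sum>U\<in>orb ` I. card U)" using fibre by (intro sum_mono) auto
  also have "\<dots> = card (\<Union> (orb ` I))"
  proof (rule card_Union_disjoint[symmetric])
    show "pairwise disjnt (orb ` I)"
      using disjoint_union orbs by (auto simp: pairwise_def disjnt_def)
    show "finite U" if "U \<in> orb ` I" for U using sub[OF that] finite_subset by blast
  qed
  also have "\<dots> \<le> card {1..m}" using sub by (intro card_mono) auto
  finally show ?thesis by simp
qed

section \<open>Central products of nilpotent groups\<close>

text \<open>A cyclic group has at most one subgroup of order \<open>p\<close>, and \<open>z\<close> is a generator of it. A
  chosen element, unlike a subgroup, can be carried along an isomorphism \<open>\<phi>\<close> to give the pairs
  \<open>(z, \<phi> z)\<close> that the central product makes trivial.\<close>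

definition generates_p_torsion :: "('a, 'm) monoid_scheme \<Rightarrow> nat \<Rightarrow> 'a \<Rightarrow> bool"
  where "generates_p_torsion C p z \<longleftrightarrow> z \<in> carrier C \<and> z \<noteq> \<one>\<^bsub>C\<^esub> \<and> z [^]\<^bsub>C\<^esub> p = \<one>\<^bsub>C\<^esub> \<and>
    (\<forall>x\<in>carrier C. x [^]\<^bsub>C\<^esub> p = \<one>\<^bsub>C\<^esub> \<longrightarrow> (\<exists>k::nat. x = z [^]\<^bsub>C\<^esub> k))"

text \<open>In the use below, \<open>z i\<close> generates the subgroup of order \<open>p i\<close>, and the condition says that
  every nontrivial subgroup of \<open>C\<close> contains one of the \<open>z i\<close>.\<close>

definition powers_reach :: "('a, 'm) monoid_scheme \<Rightarrow> 'i set \<Rightarrow> ('i \<Rightarrow> 'a) \<Rightarrow> bool"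
  where "powers_reach C I z \<longleftrightarrow>
    (\<forall>y\<in>carrier C. y \<noteq> \<one>\<^bsub>C\<^esub> \<longrightarrow> (\<exists>i\<in>I. \<exists>k::nat. y [^]\<^bsub>C\<^esub> k = z i))"

lemma nat_pow_restrict: "x [^]\<^bsub>G\<lparr>carrier := S\<rparr>\<^esub> (k::nat) = x [^]\<^bsub>G\<^esub> k"
  by (simp add: nat_pow_def)

lemma center_in_carrier: "z \<in> center G \<Longrightarrow> z \<in> carrier G"
  by (simp add: center_def)

lemma generates_p_torsion_center_iff:
  "generates_p_torsion (G\<lparr>carrier := center G\<rparr>) p z \<longleftrightarrow>
    z \<in> center G \<and> z \<noteq> \<one>\<^bsub>G\<^esub> \<and> z [^]\<^bsub>G\<^esub> p = \<one>\<^bsub>G\<^esub> \<and>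
    (\<forall>x\<in>center G. x [^]\<^bsub>G\<^esub> p = \<one>\<^bsub>G\<^esub> \<longrightarrow> (\<exists>k::nat. x = z [^]\<^bsub>G\<^esub> k))"
  by (simp add: generates_p_torsion_def nat_pow_restrict)

lemma (in group) largest_subgroup_avoiding:
  assumes fin: "finite (carrier G)" and P: "subgroup P G" and z: "z \<noteq> \<one>"
  obtains W where "subgroup W G" "W \<subseteq> P" "z \<notin> W"
    "\<And>Y. subgroup Y G \<Longrightarrow> Y \<subseteq> P \<Longrightarrow> z \<notin> Y \<Longrightarrow> card Y \<le> card W"
proof -
  let ?S = "{Y. subgroup Y G \<and> Y \<subseteq> P \<and> z \<notin> Y}"
  have "?S \<subseteq> Pow (carrier G)" using subgroup.subset by blast
  hence f: "finite ?S" using fin finite_subset by blast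
  have "{\<one>} \<in> ?S" using z triv_subgroup subgroup.one_closed[OF P] by auto
  hence "Max (card ` ?S) \<in> card ` ?S" using f by (intro Max_in) auto
  then obtain W where W: "W \<in> ?S" "card W = Max (card ` ?S)" by auto
  have "card Y \<le> card W" if "Y \<in> ?S" for Y
    unfolding W(2) using f that by (intro Max_ge) auto
  thus ?thesis using that W(1) by blast
qed

text \<open>Extended by the complements of the Sylow subgroups, the \<open>W i\<close> become subgroups of the
  same index in the whole group that still avoid \<open>z i\<close>. Their common core is a normal
  subgroup; if it were nontrivial, it would contain a nontrivial central element, and
  one of the \<open>z i\<close> among its powers.\<close>

lemma (in group) mu_le_sum_sylow_index:
  fixes p :: "'i \<Rightarrow> nat"
  assumes nil: "nilpotent_group G" and fin: "finite (carrier G)" and I: "finite I"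
    and p: "\<And>i. i \<in> I \<Longrightarrow> Factorial_Ring.prime (p i)"
    and P: "\<And>i. i \<in> I \<Longrightarrow> sylow_subgroup (p i) G (P i)"
    and W: "\<And>i. i \<in> I \<Longrightarrow> subgroup (W i) G" "\<And>i. i \<in> I \<Longrightarrow> W i \<subseteq> P i"
    and z: "\<And>i. i \<in> I \<Longrightarrow> z i \<in> P i" "\<And>i. i \<in> I \<Longrightarrow> z i \<notin> W i"
    and det: "powers_reach (G\<lparr>carrier := center G\<rparr>) I z"
  shows "mu G \<le> (\<Sum>i\<in>I. card (P i) div card (W i))"
proof -
  have "\<exists>Y. subgroup Y G \<and> Y \<inter> P i = W i \<and> card Y * card (P i) = card (W i) * order G"
    if "i \<in> I" for i
    using nilpotent_sylow_subgroup_extends[OF nil fin p[OF that] P[OF that] W(1,2)[OF that]] by metis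
  then obtain Y where Y: "\<And>i. i \<in> I \<Longrightarrow> subgroup (Y i) G" "\<And>i. i \<in> I \<Longrightarrow> Y i \<inter> P i = W i"
    "\<And>i. i \<in> I \<Longrightarrow> card (Y i) * card (P i) = card (W i) * order G" by metis
  have n0: "order G > 0" using fin order_gt_0_iff_finite by simp
  have idx: "card (rcosets (Y i)) = card (P i) div card (W i)" if i: "i \<in> I" for i
  proof -
    have l: "card (rcosets (Y i)) * card (Y i) = order G" using lagrange Y(1)[OF i] by blast
    have pos: "card (W i) > 0" using card_subgroup_pos[OF fin W(1)[OF i]] .
    have "card (rcosets (Y i)) * card (W i) * order G = card (rcosets (Y i)) * (card (Y i) * card (P i))"
      using Y(3)[OF i] by simp
    also have "\<dots> = card (P i) * order G" using l by (metis mult.assoc mult.commute)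
    finally have "card (rcosets (Y i)) * card (W i) = card (P i)" using n0 by simp
    thus ?thesis using pos by (metis div_mult_self_is_m)
  qed
  have "mon G (sym_group (\<Sum>i\<in>I. card (rcosets (Y i)))) \<noteq> {}"
  proof (rule mon_sym_group_of_subgroups[OF fin I Y(1)])
    fix g assume g: "g \<in> carrier G"
      and core: "\<And>i x. i \<in> I \<Longrightarrow> x \<in> carrier G \<Longrightarrow> x \<otimes> g \<otimes> inv x \<in> Y i"
    define N where "N = {g \<in> carrier G. \<forall>i\<in>I. \<forall>x\<in>carrier G. x \<otimes> g \<otimes> inv x \<in> Y i}"
    have "subgroup N G"
    proof (rule subgroupI)
      show "N \<subseteq> carrier G" by (auto simp: N_def)
      show "N \<noteq> {}" using g core by (auto simp: N_def)
      fix a assume a: "a \<in> N"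
      show "inv a \<in> N" unfolding N_def
      proof (intro CollectI conjI ballI)
        show "inv a \<in> carrier G" using a by (simp add: N_def)
        fix i x assume i: "i \<in> I" and x: "x \<in> carrier G"
        have "inv (x \<otimes> a \<otimes> inv x) \<in> Y i"
          using a i x subgroup.m_inv_closed[OF Y(1)[OF i]] by (simp add: N_def)
        thus "x \<otimes> inv a \<otimes> inv x \<in> Y i" using a x by (simp add: N_def inv_mult_group m_assoc)
      qed
      fix b assume b: "b \<in> N"
      show "a \<otimes> b \<in> N" unfolding N_def
      proof (intro CollectI conjI ballI)
        show "a \<otimes> b \<in> carrier G" using a b by (simp add: N_def)
        fix i x assume i: "i \<in> I" and x: "x \<in> carrier G"
        have c: "a \<in> carrier G" "b \<in> carrier G" using a b by (auto simp: N_def)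
        have "(x \<otimes> a \<otimes> inv x) \<otimes> (x \<otimes> b \<otimes> inv x) \<in> Y i"
          using a b i x subgroup.m_closed[OF Y(1)[OF i]] by (simp add: N_def)
        moreover have "(x \<otimes> a \<otimes> inv x) \<otimes> (x \<otimes> b \<otimes> inv x) = x \<otimes> (a \<otimes> b) \<otimes> inv x"
        proof -
          have "inv x \<otimes> (x \<otimes> (b \<otimes> inv x)) = b \<otimes> inv x" using x c by (simp add: m_assoc[symmetric])
          thus ?thesis using x c by (simp add: m_assoc)
        qed
        ultimately show "x \<otimes> (a \<otimes> b) \<otimes> inv x \<in> Y i" by simp
      qed
    qed
    moreover have "y \<otimes> h \<otimes> inv y \<in> N" if y: "y \<in> carrier G" and h: "h \<in> N" for y h
      unfolding N_def
    proof (intro CollectI conjI ballI)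
      have hc: "h \<in> carrier G" using h by (simp add: N_def)
      show "y \<otimes> h \<otimes> inv y \<in> carrier G" using y hc by simp
      fix i x assume i: "i \<in> I" and x: "x \<in> carrier G"
      have "(x \<otimes> y) \<otimes> h \<otimes> inv (x \<otimes> y) \<in> Y i" using h i x y by (simp add: N_def)
      thus "x \<otimes> (y \<otimes> h \<otimes> inv y) \<otimes> inv x \<in> Y i" using x y hc by (simp add: m_assoc inv_mult_group)
    qed
    ultimately have N: "N \<lhd> G" by (rule normal_invI)
    show "g = \<one>"
    proof (rule ccontr)
      assume "g \<noteq> \<one>"
      hence "N \<noteq> {\<one>}" using g core by (auto simp: N_def)
      then obtain y where y: "y \<in> N" "y \<in> center G" "y \<noteq> \<one>"
        using nilpotent_normal_meets_center[OF nil N] by blast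
      then obtain i and k :: nat where i: "i \<in> I" "y [^] k = z i"
        using det unfolding powers_reach_def nat_pow_restrict by auto
      have sN: "subgroup N G" using N normal_imp_subgroup by blast
      have "y [^] k \<in> N"
        using y(1) subgroup.m_closed[OF sN] subgroup.one_closed[OF sN] by (induction k) auto
      hence zN: "z i \<in> N" using i by simp
      hence "z i \<in> carrier G" by (simp add: N_def)
      moreover have "\<one> \<otimes> z i \<otimes> inv \<one> \<in> Y i" using zN i(1) unfolding N_def by blast
      ultimately have "z i \<in> Y i" by simp
      hence "z i \<in> W i" using Y(2)[OF i(1)] z(1)[OF i(1)] by auto
      thus False using z(2)[OF i(1)] by blast
    qed
  qed
  thus ?thesis using mu_le idx by (metis (no_types, lifting) sum.cong)
qed

text \<open>The bound of \<open>twisted_subgroup_index\<close> for Sylow subgroups, with the subgroup that it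
  provides replaced by the largest one that avoids \<open>z\<close>.\<close>

lemma sylow_twisted_index:
  fixes p :: nat
  assumes nilG: "nilpotent_group G" "finite (carrier G)" and nilH: "nilpotent_group H" "finite (carrier H)"
    and p: "Factorial_Ring.prime p" "odd p"
    and P: "sylow_subgroup p G P" and R: "sylow_subgroup p H R" and nc: "\<not> comm_group (H\<lparr>carrier := R\<rparr>)"
    and z: "z \<in> P" and w: "generates_p_torsion (H\<lparr>carrier := center H\<rparr>) p w"
    and W: "\<And>Y. subgroup Y G \<Longrightarrow> Y \<subseteq> P \<Longrightarrow> z \<notin> Y \<Longrightarrow> card Y \<le> card W"
    and L: "subgroup L (G \<times>\<times> H)" "L \<subseteq> P \<times> R" "(z, w) \<in> L" "(z, \<one>\<^bsub>H\<^esub>) \<notin> L"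
  shows "p * (card P div card W) * card L \<le> card P * card R"
proof -
  have gG: "group G" and gH: "group H" using nilG nilH by (auto simp: nilpotent_group_def)
  interpret G: group G by fact
  interpret H: group H by fact
  interpret T: group "G \<times>\<times> H" using DirProd_group gG gH by blast
  have sP: "subgroup P G" and sR: "subgroup R H" using P R by (auto simp: sylow_subgroup_def)
  have A: "group (G\<lparr>carrier := P\<rparr>)" using sP G.subgroup_imp_group by blast
  have B: "nilpotent_group (H\<lparr>carrier := R\<rparr>)" using H.nilpotent_subgroup nilH sR by blast
  have fP: "finite (carrier (G\<lparr>carrier := P\<rparr>))"
    using nilG(2) subgroup.subset[OF sP] finite_subset by auto
  have oB: "order (H\<lparr>carrier := R\<rparr>) = p ^ multiplicity p (order H)"
    using R by (simp add: sylow_subgroup_def order_def)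
  have wR: "w \<in> R"
    using H.nilpotent_sylow_contains_p_elements[OF nilH p(1) R, of w 1] w
    by (simp add: generates_p_torsion_center_iff center_in_carrier)
  have cR: "center (H\<lparr>carrier := R\<rparr>) = center H \<inter> R" using H.nilpotent_sylow_center[OF nilH p(1) R] .
  have pow: "x [^]\<^bsub>H\<lparr>carrier := R\<rparr>\<^esub> k = x [^]\<^bsub>H\<^esub> k" for x and k :: nat
    by (simp add: H.nat_pow_consistent[symmetric])
  have "G\<lparr>carrier := P\<rparr> \<times>\<times> H\<lparr>carrier := R\<rparr> = (G \<times>\<times> H)\<lparr>carrier := P \<times> R\<rparr>"
    by (simp add: DirProd_def)
  moreover have "subgroup (P \<times> R) (G \<times>\<times> H)" using DirProd_subgroups gG gH sP sR by blast
  ultimately have L': "subgroup L (G\<lparr>carrier := P\<rparr> \<times>\<times> H\<lparr>carrier := R\<rparr>)"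
    using T.subgroup_incl L by metis
  have "\<exists>Y. subgroup Y (G\<lparr>carrier := P\<rparr>) \<and> z \<notin> Y \<and> p * card L \<le> card Y * order (H\<lparr>carrier := R\<rparr>)"
    by (rule twisted_subgroup_index[where w = w, OF A fP B p oB nc _ _ _ _ L'])
      (use w wR cR L pow in \<open>auto simp: generates_p_torsion_center_iff\<close>)
  then obtain Y where Y: "subgroup Y (G\<lparr>carrier := P\<rparr>)" "z \<notin> Y" "p * card L \<le> card Y * card R"
    by (auto simp: order_def)
  have "subgroup Y G" "Y \<subseteq> P" using Y(1) G.incl_subgroup[OF sP] subgroup.subset by fastforce+
  hence "card Y \<le> card W" using W Y(2) by blast
  hence "p * card L \<le> card W * card R" using Y(3) by (meson le_trans mult_le_mono1)
  hence "(card P div card W) * (p * card L) \<le> (card P div card W) * (card W * card R)" by simp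
  also have "\<dots> \<le> card P * card R" by (simp add: mult.assoc[symmetric])
  finally show ?thesis by (simp add: mult.commute mult.left_commute)
qed

lemma swap_subgroup_DirProd:
  assumes "group G" "group H" "subgroup L (G \<times>\<times> H)"
  shows "subgroup (prod.swap ` L) (H \<times>\<times> G)"
proof -
  have "group_hom (G \<times>\<times> H) (H \<times>\<times> G) prod.swap"
    using DirProd_group[OF assms(1,2)] DirProd_group[OF assms(2,1)]
    by (auto simp: group_hom_def group_hom_axioms_def hom_def)
  thus ?thesis using group_hom.subgroup_img_is_subgroup assms(3) by blast
qed

text \<open>Intersecting \<open>L\<close> with the normal Sylow subgroup \<open>P \<times> R\<close> isolates the \<open>p\<close>-part of its
  index. The bound for \<open>H\<close> is the one for \<open>G\<close> after exchanging the factors, since \<open>L\<close>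
  omits \<open>(1, w)\<close> as well.\<close>

lemma p_local_index:
  fixes p :: nat
  assumes nilG: "nilpotent_group G" "finite (carrier G)" and nilH: "nilpotent_group H" "finite (carrier H)"
    and p: "Factorial_Ring.prime p" "odd p"
    and P: "sylow_subgroup p G P" "\<not> comm_group (G\<lparr>carrier := P\<rparr>)"
    and R: "sylow_subgroup p H R" "\<not> comm_group (H\<lparr>carrier := R\<rparr>)"
    and z: "generates_p_torsion (G\<lparr>carrier := center G\<rparr>) p z" and w: "generates_p_torsion (H\<lparr>carrier := center H\<rparr>) p w"
    and V: "\<And>Y. subgroup Y G \<Longrightarrow> Y \<subseteq> P \<Longrightarrow> z \<notin> Y \<Longrightarrow> card Y \<le> card V"
    and W: "\<And>Y. subgroup Y H \<Longrightarrow> Y \<subseteq> R \<Longrightarrow> w \<notin> Y \<Longrightarrow> card Y \<le> card W"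
    and L: "subgroup L (G \<times>\<times> H)" "(z, w) \<in> L" "(z, \<one>\<^bsub>H\<^esub>) \<notin> L"
  shows "\<exists>k. p * max (card P div card V) (card R div card W) \<le> p ^ k \<and> p ^ k * card L dvd order (G \<times>\<times> H)"
proof -
  have gG: "group G" and gH: "group H" using nilG nilH by (auto simp: nilpotent_group_def)
  interpret G: group G by fact
  interpret H: group H by fact
  interpret T: group "G \<times>\<times> H" using DirProd_group gG gH by blast
  have fT: "finite (carrier (G \<times>\<times> H))" using nilG nilH by simp
  have sP: "subgroup P G" and sR: "subgroup R H" using P R by (auto simp: sylow_subgroup_def)
  have zP: "z \<in> P"
    using G.nilpotent_sylow_contains_p_elements[OF nilG p(1) P(1), of z 1] z
    by (simp add: generates_p_torsion_center_iff center_in_carrier)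
  have wR: "w \<in> R"
    using H.nilpotent_sylow_contains_p_elements[OF nilH p(1) R(1), of w 1] w
    by (simp add: generates_p_torsion_center_iff center_in_carrier)
  have zc: "z \<in> carrier G" and wc: "w \<in> carrier H" using zP wR sP sR subgroup.mem_carrier by metis+
  have nPR: "P \<times> R \<lhd> G \<times>\<times> H"
    using G.DirProd_normal[OF gH] G.nilpotent_sylow_normal[OF nilG p(1) P(1)]
      H.nilpotent_sylow_normal[OF nilH p(1) R(1)] by blast
  have sPR: "subgroup (P \<times> R) (G \<times>\<times> H)" using nPR normal_imp_subgroup by blast
  define M where "M = L \<inter> (P \<times> R)"
  have sM: "subgroup M (G \<times>\<times> H)" unfolding M_def using subgroup_Int L(1) sPR by blast
  have Mp: "card M > 0" using T.card_subgroup_pos[OF fT sM] .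
  have cPR: "card (P \<times> R) = p ^ (multiplicity p (order G) + multiplicity p (order H))"
    using P R by (simp add: sylow_subgroup_def card_cartesian_product power_add)
  have "card M dvd card (P \<times> R)" using T.card_subgroup_dvd[OF sM sPR] by (simp add: M_def)
  then obtain q where q: "card (P \<times> R) = card M * q" by blast
  then obtain k where k: "q = p ^ k" using cPR divides_primepow_nat[OF p(1)] by (metis dvd_triv_right)
  have prod: "p ^ k * card M = card P * card R"
    using q k by (simp add: card_cartesian_product mult.commute)
  have "subgroup (L <#>\<^bsub>G \<times>\<times> H\<^esub> (P \<times> R)) (G \<times>\<times> H)"
    using T.mult_norm_subgroup[OF nPR L(1)] T.commut_normal[OF L(1) nPR] by simp
  hence "card (L <#>\<^bsub>G \<times>\<times> H\<^esub> (P \<times> R)) dvd order (G \<times>\<times> H)"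
    unfolding order_def using T.card_subgroup_dvd[OF _ T.subgroup_self] subgroup.subset by blast
  moreover have "card (L <#>\<^bsub>G \<times>\<times> H\<^esub> (P \<times> R)) = p ^ k * card L"
    using T.card_set_mult_subgroups[OF L(1) sPR fT] q k Mp by (simp add: M_def[symmetric] mult.commute mult.left_commute)
  ultimately have dvd: "p ^ k * card L dvd order (G \<times>\<times> H)" by simp
  have w1: "(\<one>\<^bsub>G\<^esub>, w) \<notin> L"
  proof
    assume "(\<one>\<^bsub>G\<^esub>, w) \<in> L"
    hence "(z, w) \<otimes>\<^bsub>G \<times>\<times> H\<^esub> inv\<^bsub>G \<times>\<times> H\<^esub> (\<one>\<^bsub>G\<^esub>, w) \<in> L"
      using L by (meson subgroup.m_closed subgroup.m_inv_closed)
    thus False using L(3) zc wc gG gH by (simp add: inv_DirProd)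
  qed
  have "p * (card P div card V) * card M \<le> card P * card R"
    by (rule sylow_twisted_index[OF nilG nilH p P(1) R zP w V sM])
      (use L zP wR in \<open>auto simp: M_def\<close>)
  hence 1: "p * (card P div card V) \<le> p ^ k" using prod Mp by (metis mult_le_cancel2)
  have "p * (card R div card W) * card (prod.swap ` M) \<le> card R * card P"
    by (rule sylow_twisted_index[OF nilH nilG p R(1) P wR z W swap_subgroup_DirProd[OF gG gH sM]])
      (use L zP wR w1 in \<open>auto simp: M_def\<close>)
  hence 2: "p * (card R div card W) \<le> p ^ k"
    using prod Mp by (metis card_image inj_swap mult.commute mult_le_cancel2)
  have "p * max (card P div card V) (card R div card W) \<le> p ^ k" using 1 2 by (simp add: max_def)
  thus ?thesis using dvd by blast
qed

text \<open>The numbers \<open>d i\<close> and \<open>e i\<close> below are the least indices in \<open>P i\<close> and \<open>R i\<close> of subgroups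
  that avoid \<open>z i\<close> and \<open>w i\<close>. The sum of the minimal degrees is at most
  \<open>\<Sum>i\<in>I. d i + e i\<close>, while the action identifies \<open>z i\<close> with the inverse of \<open>w i\<close> and
  therefore needs \<open>p i * max (d i) (e i)\<close> points for each \<open>i\<close>. As \<open>p i\<close> is at least
  three, this is strictly more.\<close>

theorem mu_sum_less_degree_of_central_action:
  fixes p :: "'i \<Rightarrow> nat"
  assumes nilG: "nilpotent_group G" "finite (carrier G)" and nilH: "nilpotent_group H" "finite (carrier H)"
    and I: "finite I" "I \<noteq> {}" "inj_on p I"
    and p: "\<And>i. i \<in> I \<Longrightarrow> Factorial_Ring.prime (p i)" "\<And>i. i \<in> I \<Longrightarrow> odd (p i)"
    and P: "\<And>i. i \<in> I \<Longrightarrow> sylow_subgroup (p i) G (P i)" "\<And>i. i \<in> I \<Longrightarrow> \<not> comm_group (G\<lparr>carrier := P i\<rparr>)"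
    and R: "\<And>i. i \<in> I \<Longrightarrow> sylow_subgroup (p i) H (R i)" "\<And>i. i \<in> I \<Longrightarrow> \<not> comm_group (H\<lparr>carrier := R i\<rparr>)"
    and z: "\<And>i. i \<in> I \<Longrightarrow> generates_p_torsion (G\<lparr>carrier := center G\<rparr>) (p i) (z i)" and dz: "powers_reach (G\<lparr>carrier := center G\<rparr>) I z"
    and w: "\<And>i. i \<in> I \<Longrightarrow> generates_p_torsion (H\<lparr>carrier := center H\<rparr>) (p i) (w i)" and dw: "powers_reach (H\<lparr>carrier := center H\<rparr>) I w"
    and \<rho>: "\<rho> \<in> hom (G \<times>\<times> H) (sym_group m)"
    and ker: "\<And>i. i \<in> I \<Longrightarrow> \<rho> (z i, w i) = id" "\<And>i. i \<in> I \<Longrightarrow> \<rho> (z i, \<one>\<^bsub>H\<^esub>) \<noteq> id"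
  shows "mu G + mu H < m"
proof -
  have gG: "group G" and gH: "group H" using nilG nilH by (auto simp: nilpotent_group_def)
  interpret G: group G by fact
  interpret H: group H by fact
  have sP: "subgroup (P i) G" and sR: "subgroup (R i) H" if "i \<in> I" for i
    using P(1)[OF that] R(1)[OF that] by (auto simp: sylow_subgroup_def)
  have z1: "z i \<noteq> \<one>\<^bsub>G\<^esub>" "w i \<noteq> \<one>\<^bsub>H\<^esub>" "z i \<in> carrier G" "w i \<in> carrier H"
    "z i [^]\<^bsub>G\<^esub> p i = \<one>\<^bsub>G\<^esub>" "w i [^]\<^bsub>H\<^esub> p i = \<one>\<^bsub>H\<^esub>" if "i \<in> I" for i
    using z[OF that] w[OF that] by (auto simp: generates_p_torsion_center_iff center_in_carrier)
  have zP: "z i \<in> P i" and wR: "w i \<in> R i" if i: "i \<in> I" for i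
    using G.nilpotent_sylow_contains_p_elements[OF nilG p(1)[OF i] P(1)[OF i], of "z i" 1]
      H.nilpotent_sylow_contains_p_elements[OF nilH p(1)[OF i] R(1)[OF i], of "w i" 1] z1[OF i] by auto
  have "\<exists>V. subgroup V G \<and> V \<subseteq> P i \<and> z i \<notin> V \<and>
    (\<forall>Y. subgroup Y G \<longrightarrow> Y \<subseteq> P i \<longrightarrow> z i \<notin> Y \<longrightarrow> card Y \<le> card V)" if i: "i \<in> I" for i
    using G.largest_subgroup_avoiding[OF nilG(2) sP[OF i] z1(1)[OF i]] by metis
  then obtain V where V: "\<And>i. i \<in> I \<Longrightarrow> subgroup (V i) G" "\<And>i. i \<in> I \<Longrightarrow> V i \<subseteq> P i"
    "\<And>i. i \<in> I \<Longrightarrow> z i \<notin> V i"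
    "\<And>i Y. i \<in> I \<Longrightarrow> subgroup Y G \<Longrightarrow> Y \<subseteq> P i \<Longrightarrow> z i \<notin> Y \<Longrightarrow> card Y \<le> card (V i)" by metis
  have "\<exists>V. subgroup V H \<and> V \<subseteq> R i \<and> w i \<notin> V \<and>
    (\<forall>Y. subgroup Y H \<longrightarrow> Y \<subseteq> R i \<longrightarrow> w i \<notin> Y \<longrightarrow> card Y \<le> card V)" if i: "i \<in> I" for i
    using H.largest_subgroup_avoiding[OF nilH(2) sR[OF i] z1(2)[OF i]] by metis
  then obtain W where W: "\<And>i. i \<in> I \<Longrightarrow> subgroup (W i) H" "\<And>i. i \<in> I \<Longrightarrow> W i \<subseteq> R i"
    "\<And>i. i \<in> I \<Longrightarrow> w i \<notin> W i"
    "\<And>i Y. i \<in> I \<Longrightarrow> subgroup Y H \<Longrightarrow> Y \<subseteq> R i \<Longrightarrow> w i \<notin> Y \<Longrightarrow> card Y \<le> card (W i)" by metis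
  define d where "d = (\<lambda>i. card (P i) div card (V i))"
  define e where "e = (\<lambda>i. card (R i) div card (W i))"
  define c where "c = (\<lambda>i. p i * max (d i) (e i))"
  have d: "d i \<ge> 1" if i: "i \<in> I" for i
    unfolding d_def
    using G.card_subgroup_dvd[OF V(1) sP V(2), OF i i i] G.card_subgroup_pos[OF nilG(2)] sP[OF i] V(1)[OF i]
    by (metis One_nat_def Suc_leI div_greater_zero_iff dvd_imp_le)
  have c3: "3 * max (d i) (e i) \<le> c i" if i: "i \<in> I" for i
  proof -
    have "p i \<ge> 2" using p(1)[OF i] prime_ge_2_nat by blast
    hence "p i \<ge> 3" using p(2)[OF i] by (cases "p i = 2") auto
    thus ?thesis by (simp add: c_def)
  qed
  have "mu G + mu H \<le> (\<Sum>i\<in>I. d i) + (\<Sum>i\<in>I. e i)"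
    unfolding d_def e_def
    using G.mu_le_sum_sylow_index[where z = z, OF nilG I(1) p(1) P(1) V(1,2) zP V(3) dz]
      H.mu_le_sum_sylow_index[where z = w, OF nilH I(1) p(1) R(1) W(1,2) wR W(3) dw]
    by (meson add_mono)
  also have "\<dots> = (\<Sum>i\<in>I. d i + e i)" by (simp add: sum.distrib)
  also have "\<dots> < (\<Sum>i\<in>I. c i)"
  proof (rule sum_strict_mono[OF I(1,2)])
    fix i assume "i \<in> I"
    thus "d i + e i < c i" using c3[of i] d[of i] by linarith
  qed
  also have "\<dots> \<le> m"
  proof (rule sum_index_bounds_le_degree[where t = "\<lambda>i. (z i, \<one>\<^bsub>H\<^esub>)", OF _ _ \<rho> I(1,3) p(1)])
    show "group (G \<times>\<times> H)" using DirProd_group gG gH by blast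
    show "finite (carrier (G \<times>\<times> H))" using nilG nilH by simp
    fix i assume i: "i \<in> I"
    show "(z i, \<one>\<^bsub>H\<^esub>) \<in> carrier (G \<times>\<times> H)" using z1[OF i] by simp
    show "\<rho> (z i, \<one>\<^bsub>H\<^esub>) \<noteq> id" using ker i by blast
    show "2 \<le> c i" using c3[OF i] d[OF i] by linarith
    fix L assume L: "subgroup L (G \<times>\<times> H)" "\<And>x. x \<in> carrier (G \<times>\<times> H) \<Longrightarrow> \<rho> x = id \<Longrightarrow> x \<in> L"
      "(z i, \<one>\<^bsub>H\<^esub>) \<notin> L"
    have "(z i, w i) \<in> L" using L(2) ker(1)[OF i] z1[OF i] by simp
    thus "\<exists>k. c i \<le> p i ^ k \<and> p i ^ k * card L dvd order (G \<times>\<times> H)"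
      unfolding c_def d_def e_def
      using p_local_index[OF nilG nilH p(1)[OF i] p(2)[OF i] P(1)[OF i] P(2)[OF i] R(1)[OF i] R(2)[OF i]
          z[OF i] w[OF i] V(4)[OF i] W(4)[OF i] L(1) _ L(3)] by blast
  qed
  finally show ?thesis .
qed

section \<open>The centre as a product of cyclic groups\<close>

lemma iso_generates_p_torsion:
  assumes "group C" "group D" and \<psi>: "\<psi> \<in> iso C D" and z: "generates_p_torsion C p z"
  shows "generates_p_torsion D p (\<psi> z)"
proof -
  have hom: "\<psi> \<in> hom C D" and bij: "bij_betw \<psi> (carrier C) (carrier D)"
    using \<psi> by (auto simp: iso_def)
  interpret group_hom C D \<psi>
    using assms hom by (simp add: group_hom_def group_hom_axioms_def)
  have zc: "z \<in> carrier C" using z by (simp add: generates_p_torsion_def)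
  have inj: "x = \<one>\<^bsub>C\<^esub>" if "x \<in> carrier C" "\<psi> x = \<one>\<^bsub>D\<^esub>" for x
    using that bij by (metis G.one_closed bij_betw_def hom_one inj_onD)
  show ?thesis unfolding generates_p_torsion_def
  proof (intro conjI ballI impI)
    show "\<psi> z \<in> carrier D" using zc by simp
    show "\<psi> z \<noteq> \<one>\<^bsub>D\<^esub>" using z inj zc by (auto simp: generates_p_torsion_def)
    show "\<psi> z [^]\<^bsub>D\<^esub> p = \<one>\<^bsub>D\<^esub>"
      using z zc by (metis generates_p_torsion_def hom_nat_pow hom_one)
    fix y assume y: "y \<in> carrier D" "y [^]\<^bsub>D\<^esub> p = \<one>\<^bsub>D\<^esub>"
    then obtain x where x: "x \<in> carrier C" "y = \<psi> x" using bij by (auto simp: bij_betw_def)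
    have "\<psi> (x [^]\<^bsub>C\<^esub> p) = \<one>\<^bsub>D\<^esub>" using x y by (simp add: hom_nat_pow)
    hence "x [^]\<^bsub>C\<^esub> p = \<one>\<^bsub>C\<^esub>" using inj x by simp
    then obtain k :: nat where "x = z [^]\<^bsub>C\<^esub> k" using z x by (auto simp: generates_p_torsion_def)
    thus "\<exists>k::nat. y = \<psi> z [^]\<^bsub>D\<^esub> k" using x zc hom_nat_pow by blast
  qed
qed

lemma iso_powers_reach:
  assumes "group C" "group D" and \<psi>: "\<psi> \<in> iso C D" and z: "powers_reach C I z"
  shows "powers_reach D I (\<lambda>i. \<psi> (z i))"
proof -
  have hom: "\<psi> \<in> hom C D" and bij: "bij_betw \<psi> (carrier C) (carrier D)"
    using \<psi> by (auto simp: iso_def)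
  interpret group_hom C D \<psi>
    using assms hom by (simp add: group_hom_def group_hom_axioms_def)
  show ?thesis unfolding powers_reach_def
  proof (intro ballI impI)
    fix y assume y: "y \<in> carrier D" "y \<noteq> \<one>\<^bsub>D\<^esub>"
    then obtain x where x: "x \<in> carrier C" "y = \<psi> x" using bij by (auto simp: bij_betw_def)
    hence "x \<noteq> \<one>\<^bsub>C\<^esub>" using y by auto
    then obtain i and k :: nat where "i \<in> I" "x [^]\<^bsub>C\<^esub> k = z i"
      using z x by (auto simp: powers_reach_def)
    thus "\<exists>i\<in>I. \<exists>k::nat. y [^]\<^bsub>D\<^esub> k = \<psi> (z i)" using x hom_nat_pow by metis
  qed
qed

text \<open>Every nontrivial element has a power of prime order, the prime is one of the \<open>p i\<close>, and
  a power of order \<open>p i\<close> generates the same subgroup as \<open>z i\<close>.\<close>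

lemma (in group) powers_reach_of_order:
  fixes p \<alpha> :: "'i \<Rightarrow> nat"
  assumes fin: "finite (carrier G)" and ord: "order G = (\<Prod>i\<in>I. p i ^ \<alpha> i)"
    and p: "\<And>i. i \<in> I \<Longrightarrow> Factorial_Ring.prime (p i)"
    and z: "\<And>i. i \<in> I \<Longrightarrow> generates_p_torsion G (p i) (z i)"
  shows "powers_reach G I z"
  unfolding powers_reach_def
proof (intro ballI impI)
  fix y assume y: "y \<in> carrier G" "y \<noteq> \<one>"
  hence "ord y \<noteq> 1" using ord_eq_1 by blast
  then obtain q where q: "Factorial_Ring.prime q" "q dvd ord y" using prime_factor_nat by blast
  have "q dvd order G" using q ord_dvd_group_order[OF y(1)] dvd_trans by blast
  have finI: "finite I"
  proof (rule ccontr)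
    assume "infinite I"
    hence "q dvd 1" using \<open>q dvd order G\<close> ord by simp
    thus False using q by simp
  qed
  then obtain i where i: "i \<in> I" "q dvd p i ^ \<alpha> i"
    using \<open>q dvd order G\<close> ord prime_dvd_prod_iff[OF finI q(1)] by auto
  hence qi: "q = p i" using q p[OF i(1)] by (metis prime_dvd_power primes_dvd_imp_eq)
  obtain m where m: "ord y = q * m" using q by blast
  have "m \<noteq> 0" using m ord_ge_1[OF fin y(1)] by auto
  define x where "x = y [^] m"
  have x: "x \<in> carrier G" "x [^] p i = \<one>"
    using y m qi by (simp_all add: x_def nat_pow_pow mult.commute) (metis pow_ord_eq_1)
  have "x \<noteq> \<one>"
  proof
    assume "x = \<one>"
    hence "q * m dvd m" using y m pow_eq_id by (simp add: x_def)
    hence "q * m \<le> m" using \<open>m \<noteq> 0\<close> by (intro dvd_imp_le) auto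
    thus False using \<open>m \<noteq> 0\<close> prime_gt_1_nat[OF q(1)] by simp
  qed
  have zi: "z i \<in> carrier G" "z i [^] p i = \<one>" using z[OF i(1)] by (auto simp: generates_p_torsion_def)
  obtain k :: nat where k: "x = z i [^] k"
    using z[OF i(1)] x by (auto simp: generates_p_torsion_def)
  have "\<not> p i dvd k"
  proof
    assume "p i dvd k"
    then obtain j where "k = p i * j" by blast
    thus False using k \<open>x \<noteq> \<one>\<close> zi by (simp add: nat_pow_pow[symmetric])
  qed
  then obtain t :: nat where "x [^] t = z i" using pow_coprime_invertible[OF p[OF i(1)] _ zi] k by metis
  hence "y [^] (m * t) = z i" using y by (simp add: x_def nat_pow_pow)
  thus "\<exists>i\<in>I. \<exists>k::nat. y [^] k = z i" using i by blast
qed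

lemma nat_pow_product_integer_mod_group:
  assumes "x \<in> carrier (product_group I (\<lambda>i. integer_mod_group (n i)))"
  shows "x [^]\<^bsub>product_group I (\<lambda>i. integer_mod_group (n i))\<^esub> (k::nat)
    = (\<lambda>i\<in>I. (int k * x i) mod int (n i))"
proof (induction k)
  case (Suc k)
  show ?case
    by (simp add: Suc) (auto simp: fun_eq_iff mod_add_left_eq mod_add_right_eq algebra_simps)
qed (auto simp: fun_eq_iff)

text \<open>An element killed by \<open>p i\<close> vanishes in all components for other primes, and its
  component at \<open>i\<close> is a multiple of \<open>p i ^ (\<alpha> i - 1)\<close>.\<close>

lemma product_cyclic_generates_p_torsion:
  fixes p \<alpha> :: "'i \<Rightarrow> nat"
  assumes p: "\<And>i. i \<in> I \<Longrightarrow> Factorial_Ring.prime (p i)" and \<alpha>: "\<And>i. i \<in> I \<Longrightarrow> \<alpha> i \<ge> 1"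
    and inj: "inj_on p I" and i: "i \<in> I"
  shows "generates_p_torsion (product_group I (\<lambda>i. integer_mod_group (p i ^ \<alpha> i))) (p i)
    (\<lambda>j\<in>I. if j = i then int (p i ^ (\<alpha> i - 1)) else 0)" (is "generates_p_torsion ?C _ ?z")
proof -
  have pos: "p j ^ \<alpha> j > 0" if "j \<in> I" for j using prime_gt_0_nat[OF p[OF that]] by simp
  have car: "x \<in> carrier ?C \<longleftrightarrow> x \<in> (\<Pi>\<^sub>E j\<in>I. {0..<int (p j ^ \<alpha> j)})" for x
    using pos by (auto simp: carrier_integer_mod_group PiE_iff)
  obtain a where a: "\<alpha> i = Suc a" using \<alpha>[OF i] by (cases "\<alpha> i") auto
  have lt: "p i ^ a < p i ^ \<alpha> i" using prime_gt_1_nat[OF p[OF i]] by (simp add: a)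
  have zc: "?z \<in> carrier ?C" unfolding car using lt pos a by (auto simp: PiE_iff simp flip: of_nat_power)
  have powz: "?z [^]\<^bsub>?C\<^esub> k = (\<lambda>j\<in>I. if j = i then (int k * int (p i ^ a)) mod int (p i ^ \<alpha> i) else 0)"
    for k :: nat
    unfolding nat_pow_product_integer_mod_group[OF zc] using a by (auto simp: fun_eq_iff)
  show ?thesis unfolding generates_p_torsion_def
  proof (intro conjI ballI impI)
    show "?z \<in> carrier ?C" by fact
    show "?z \<noteq> \<one>\<^bsub>?C\<^esub>"
    proof
      assume "?z = \<one>\<^bsub>?C\<^esub>"
      hence "?z i = \<one>\<^bsub>?C\<^esub> i" by (rule fun_cong)
      thus False using i prime_gt_0_nat[OF p[OF i]] by simp
    qed
    show "?z [^]\<^bsub>?C\<^esub> p i = \<one>\<^bsub>?C\<^esub>"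
      unfolding powz by (auto simp: fun_eq_iff a)
    fix x assume x: "x \<in> carrier ?C" "x [^]\<^bsub>?C\<^esub> p i = \<one>\<^bsub>?C\<^esub>"
    have xr: "0 \<le> x j" "x j < int (p j ^ \<alpha> j)" if "j \<in> I" for j
      using x(1) that unfolding car by auto
    have dvd: "int (p j ^ \<alpha> j) dvd int (p i) * x j" if "j \<in> I" for j
    proof -
      have "(x [^]\<^bsub>?C\<^esub> p i) j = \<one>\<^bsub>?C\<^esub> j" using x(2) by simp
      thus ?thesis using that unfolding nat_pow_product_integer_mod_group[OF x(1)]
        by (simp add: mod_eq_0_iff_dvd)
    qed
    have x0: "x j = 0" if j: "j \<in> I" "j \<noteq> i" for j
    proof -
      have "p j \<noteq> p i" using inj j i by (auto dest: inj_onD)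
      hence "coprime (p j ^ \<alpha> j) (p i)"
        using p j i by (simp add: primes_coprime)
      hence "coprime (int (p j ^ \<alpha> j)) (int (p i))" by (simp only: coprime_int_iff)
      hence "int (p j ^ \<alpha> j) dvd x j" using dvd[OF j(1)] coprime_dvd_mult_right_iff by blast
      thus ?thesis using xr[OF j(1)] by (metis zdvd_not_zless less_le)
    qed
    have "int (p i) * int (p i ^ a) dvd int (p i) * x i" using dvd[OF i] by (simp add: a)
    hence "int (p i ^ a) dvd x i" using prime_gt_0_nat[OF p[OF i]] by simp
    then obtain m where m: "x i = int (p i ^ a) * m" by blast
    have "int (p i ^ a) > 0" using prime_gt_0_nat[OF p[OF i]] by simp
    hence "m \<ge> 0"
      using xr(1)[OF i] unfolding m by (metis zero_le_mult_iff not_le)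
    hence "int (nat m) * int (p i ^ a) = x i" using m by simp
    hence e: "(int (nat m) * int (p i ^ a)) mod int (p i ^ \<alpha> i) = x i" using xr[OF i] by simp
    have "x = ?z [^]\<^bsub>?C\<^esub> nat m"
    proof
      fix j show "x j = (?z [^]\<^bsub>?C\<^esub> nat m) j"
        using x(1) x0[of j] e unfolding powz car by (cases "j \<in> I") (auto simp: PiE_iff extensional_def)
    qed
    thus "\<exists>k::nat. x = ?z [^]\<^bsub>?C\<^esub> k" by blast
  qed
qed

lemma order_product_cyclic:
  assumes "finite I" "\<And>i. i \<in> I \<Longrightarrow> n i > 0"
  shows "order (product_group I (\<lambda>i. integer_mod_group (n i))) = (\<Prod>i\<in>I. n i)"
  using assms by (auto simp: order_def card_PiE carrier_integer_mod_group intro!: prod.cong)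

section \<open>The central product\<close>

lemma (in group) subgroup_center: "subgroup (center G) G"
proof (rule subgroupI)
  show "center G \<noteq> {}" by (auto simp: center_def intro!: exI[of _ \<one>])
  fix a assume "a \<in> center G"
  hence a: "a \<in> carrier G" "\<And>x. x \<in> carrier G \<Longrightarrow> x \<otimes> a = a \<otimes> x" by (auto simp: center_def)
  have "x \<otimes> inv a = inv a \<otimes> x" if x: "x \<in> carrier G" for x
  proof -
    have "inv a \<otimes> (x \<otimes> a) \<otimes> inv a = inv a \<otimes> (a \<otimes> x) \<otimes> inv a" using a(2)[OF x] by simp
    moreover have "inv a \<otimes> (x \<otimes> a) \<otimes> inv a = inv a \<otimes> x" using a(1) x by (simp add: m_assoc)
    moreover have "inv a \<otimes> (a \<otimes> x) \<otimes> inv a = x \<otimes> inv a"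
      using a(1) x by (simp add: m_assoc[symmetric])
    ultimately show ?thesis by simp
  qed
  thus "inv a \<in> center G" using a(1) by (simp add: center_def)
  fix b assume "b \<in> center G"
  hence b: "b \<in> carrier G" "\<And>x. x \<in> carrier G \<Longrightarrow> x \<otimes> b = b \<otimes> x" by (auto simp: center_def)
  have "x \<otimes> (a \<otimes> b) = (a \<otimes> b) \<otimes> x" if x: "x \<in> carrier G" for x
  proof -
    have "x \<otimes> (a \<otimes> b) = (x \<otimes> a) \<otimes> b" using a(1) b(1) x by (simp add: m_assoc)
    also have "\<dots> = a \<otimes> (x \<otimes> b)" unfolding a(2)[OF x] using a(1) b(1) x by (simp add: m_assoc)
    also have "\<dots> = (a \<otimes> b) \<otimes> x" unfolding b(2)[OF x] using a(1) b(1) x by (simp add: m_assoc)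
    finally show ?thesis .
  qed
  thus "a \<otimes> b \<in> center G" using a(1) b(1) by (simp add: center_def)
qed (auto simp: center_def)

text \<open>A subgroup that consists of central elements is normal, and the graph of \<open>\<phi>\<close> is one.\<close>

lemma central_kernel_normal:
  assumes G: "group G" and H: "group H"
    and \<phi>: "\<phi> \<in> hom (G\<lparr>carrier := center G\<rparr>) (H\<lparr>carrier := center H\<rparr>)"
  shows "central_kernel G \<phi> \<lhd> G \<times>\<times> H"
proof -
  interpret G: group G by fact
  interpret H: group H by fact
  interpret T: group "G \<times>\<times> H" using DirProd_group G H by blast
  have gZ: "group (G\<lparr>carrier := center G\<rparr>)" "group (H\<lparr>carrier := center H\<rparr>)"
    using G.subgroup_center H.subgroup_center G.subgroup_imp_group H.subgroup_imp_group by blast+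
  interpret \<phi>: group_hom "G\<lparr>carrier := center G\<rparr>" "H\<lparr>carrier := center H\<rparr>" \<phi>
    using gZ \<phi> by (simp add: group_hom_def group_hom_axioms_def)
  have cG: "z \<in> carrier G" if "z \<in> center G" for z using that by (simp add: center_def)
  have cH: "z \<in> carrier H" if "z \<in> center H" for z using that by (simp add: center_def)
  have \<phi>c: "\<phi> z \<in> center H" if "z \<in> center G" for z using \<phi>.hom_closed[of z] that by simp
  have N: "(z, y) \<in> central_kernel G \<phi> \<longleftrightarrow> z \<in> center G \<and> y = \<phi> z" for z y
    by (auto simp: central_kernel_def)
  have inv: "\<phi> (inv\<^bsub>G\<^esub> z) = inv\<^bsub>H\<^esub> (\<phi> z)" if "z \<in> center G" for z
    using \<phi>.hom_inv[of z] that \<phi>c[OF that]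
    by (simp add: G.m_inv_consistent[OF G.subgroup_center] H.m_inv_consistent[OF H.subgroup_center])
  have "subgroup (central_kernel G \<phi>) (G \<times>\<times> H)"
  proof (rule T.subgroupI)
    show "central_kernel G \<phi> \<subseteq> carrier (G \<times>\<times> H)"
      using cG cH \<phi>c by (auto simp: central_kernel_def)
    show "central_kernel G \<phi> \<noteq> {}"
      using subgroup.one_closed[OF G.subgroup_center] by (auto simp: central_kernel_def)
    fix x assume "x \<in> central_kernel G \<phi>"
    then obtain z where z: "x = (z, \<phi> z)" "z \<in> center G" by (auto simp: central_kernel_def)
    show "inv\<^bsub>G \<times>\<times> H\<^esub> x \<in> central_kernel G \<phi>"
      using z cG cH \<phi>c inv G H subgroup.m_inv_closed[OF G.subgroup_center] by (simp add: N)
    fix y assume "y \<in> central_kernel G \<phi>"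
    then obtain v where v: "y = (v, \<phi> v)" "v \<in> center G" by (auto simp: central_kernel_def)
    show "x \<otimes>\<^bsub>G \<times>\<times> H\<^esub> y \<in> central_kernel G \<phi>"
      using z v \<phi>.hom_mult[of z v] subgroup.m_closed[OF G.subgroup_center] by (simp add: N)
  qed
  moreover have "x \<otimes>\<^bsub>G \<times>\<times> H\<^esub> h \<otimes>\<^bsub>G \<times>\<times> H\<^esub> inv\<^bsub>G \<times>\<times> H\<^esub> x \<in> central_kernel G \<phi>"
    if x: "x \<in> carrier (G \<times>\<times> H)" and h: "h \<in> central_kernel G \<phi>" for x h
  proof -
    obtain z where z: "h = (z, \<phi> z)" "z \<in> center G" using h by (auto simp: central_kernel_def)
    have hc: "h \<in> carrier (G \<times>\<times> H)" using z cG cH \<phi>c by simp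
    have "x \<otimes>\<^bsub>G \<times>\<times> H\<^esub> h = h \<otimes>\<^bsub>G \<times>\<times> H\<^esub> x"
      using x z \<phi>c[OF z(2)] by (cases x) (auto simp: center_def)
    hence "x \<otimes>\<^bsub>G \<times>\<times> H\<^esub> h \<otimes>\<^bsub>G \<times>\<times> H\<^esub> inv\<^bsub>G \<times>\<times> H\<^esub> x = h"
      using x hc by (metis T.inv_closed T.m_assoc T.r_inv T.r_one)
    thus ?thesis using h by simp
  qed
  ultimately show ?thesis by (rule T.normal_invI)
qed

theorem proposition8p7:
  fixes G :: "('a, 'm) monoid_scheme" and H :: "('b, 'n) monoid_scheme"
    and G1 :: "'a set" and H1 :: "'b set"
    and r :: nat and p \<alpha> :: "nat \<Rightarrow> nat"
    and GP :: "nat \<Rightarrow> 'a set" and HP :: "nat \<Rightarrow> 'b set"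
    and \<phi> :: "'a \<Rightarrow> 'b"
  assumes "wright_class G" and "wright_class H"
    and "wright_subgroup G G1" and "wright_subgroup H H1"
    and "odd (card G1)" and "odd (card H1)"
    and "r \<ge> 1"
    and "\<And>i. i \<in> {1..r} \<Longrightarrow> Factorial_Ring.prime (p i) \<and> odd (p i) \<and> \<alpha> i \<ge> 1"
    and "inj_on p {1..r}"
    and "center G = center (G \<restriction>\<^sub>G G1)" and "center H = center (H \<restriction>\<^sub>G H1)"
    and "G \<restriction>\<^sub>G center G \<cong> product_group {1..r} (\<lambda>i. integer_mod_group (p i ^ \<alpha> i))"
    and "H \<restriction>\<^sub>G center H \<cong> product_group {1..r} (\<lambda>i. integer_mod_group (p i ^ \<alpha> i))"
    and "\<phi> \<in> iso (G \<restriction>\<^sub>G center G) (H \<restriction>\<^sub>G center H)"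
    and "\<And>i. i \<in> {1..r} \<Longrightarrow> sylow_subgroup (p i) (G \<restriction>\<^sub>G G1) (GP i)"
    and "\<And>i. i \<in> {1..r} \<Longrightarrow> sylow_subgroup (p i) (H \<restriction>\<^sub>G H1) (HP i)"
    and "\<And>i. i \<in> {1..r} \<Longrightarrow> \<not> comm_group (G \<restriction>\<^sub>G GP i)"
    and "\<And>i. i \<in> {1..r} \<Longrightarrow> \<not> comm_group (H \<restriction>\<^sub>G HP i)"
  shows "exceptional (G \<times>\<times> H) \<and>
         distinguished_kernel (G \<times>\<times> H) (central_kernel G \<phi>) \<and>
         mu (central_product G H \<phi>) > mu (G \<times>\<times> H)"
proof -
  have G: "group G" "finite (carrier G)" and H: "group H" "finite (carrier H)"
    using assms(1,2) by (auto simp: wright_class_def)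
  interpret G: group G by (rule G(1))
  interpret H: group H by (rule H(1))
  interpret T: group "G \<times>\<times> H" using DirProd_group G H by blast
  have sG1: "subgroup G1 G" and nG1: "nilpotent_group (G\<lparr>carrier := G1\<rparr>)"
    and mG1: "mu (G\<lparr>carrier := G1\<rparr>) = mu G"
    and sH1: "subgroup H1 H" and nH1: "nilpotent_group (H\<lparr>carrier := H1\<rparr>)"
    and mH1: "mu (H\<lparr>carrier := H1\<rparr>) = mu H"
    using assms(3,4) by (auto simp: wright_subgroup_def)
  have fG1: "finite (carrier (G\<lparr>carrier := G1\<rparr>))" and fH1: "finite (carrier (H\<lparr>carrier := H1\<rparr>))"
    using subgroup.subset[OF sG1] subgroup.subset[OF sH1] G(2) H(2) finite_subset by auto
  have pr: "\<And>i. i \<in> {1..r} \<Longrightarrow> Factorial_Ring.prime (p i)" "\<And>i. i \<in> {1..r} \<Longrightarrow> odd (p i)"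
    "\<And>i. i \<in> {1..r} \<Longrightarrow> \<alpha> i \<ge> 1" using assms(8) by auto
  let ?ZG = "G\<lparr>carrier := center G\<rparr>" and ?ZH = "H\<lparr>carrier := center H\<rparr>"
  let ?C = "product_group {1..r} (\<lambda>i. integer_mod_group (p i ^ \<alpha> i))"
  have gC: "group ?C" by simp
  have gZG: "group ?ZG" and gZH: "group ?ZH"
    using G.subgroup_imp_group[OF G.subgroup_center] H.subgroup_imp_group[OF H.subgroup_center] .
  obtain \<psi> where \<psi>: "\<psi> \<in> iso ?C ?ZG"
    using group.iso_sym[OF gZG assms(12)] by (auto simp: is_iso_def)
  define c where "c = (\<lambda>i. \<lambda>j\<in>{1..r}. if j = i then int (p i ^ (\<alpha> i - 1)) else 0)"
  have c: "generates_p_torsion ?C (p i) (c i)" if "i \<in> {1..r}" for i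
    unfolding c_def by (rule product_cyclic_generates_p_torsion[OF pr(1,3) assms(9) that])
  have pos: "p i ^ \<alpha> i > 0" if "i \<in> {1..r}" for i using prime_gt_0_nat[OF pr(1)[OF that]] by simp
  have ordC: "order ?C = (\<Prod>i\<in>{1..r}. p i ^ \<alpha> i)" 
    by (rule order_product_cyclic[OF finite_atLeastAtMost pos])
  have "order ?C > 0" unfolding ordC using pos by (intro prod_pos) auto
  hence "finite (carrier ?C)" using monoid.order_gt_0_iff_finite[OF group.is_monoid[OF gC]] by blast
  hence cr: "powers_reach ?C {1..r} c" using group.powers_reach_of_order[OF gC _ ordC pr(1) c] by blast
  define z where "z = (\<lambda>i. \<psi> (c i))"
  define w where "w = (\<lambda>i. \<phi> (z i))"
  have z: "generates_p_torsion ?ZG (p i) (z i)" if "i \<in> {1..r}" for i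
    unfolding z_def using iso_generates_p_torsion[OF gC gZG \<psi> c[OF that]] .
  have zr: "powers_reach ?ZG {1..r} z" unfolding z_def using iso_powers_reach[OF gC gZG \<psi> cr] .
  have w: "generates_p_torsion ?ZH (p i) (w i)" if "i \<in> {1..r}" for i
    unfolding w_def using iso_generates_p_torsion[OF gZG gZH assms(14) z[OF that]] .
  have wr: "powers_reach ?ZH {1..r} w" unfolding w_def using iso_powers_reach[OF gZG gZH assms(14) zr] .
  define N where "N = central_kernel G \<phi>"
  have \<phi>: "\<phi> \<in> hom ?ZG ?ZH" using assms(14) by (simp add: iso_def)
  have N: "N \<lhd> G \<times>\<times> H" unfolding N_def using central_kernel_normal[OF G(1) H(1) \<phi>] .
  interpret N: normal N "G \<times>\<times> H" by (rule N)
  define K where "K = (G \<times>\<times> H) Mod N"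
  have gK: "group K" unfolding K_def using N.factorgroup_is_group .
  have fT: "finite (carrier (G \<times>\<times> H))" using G H by simp
  have fK: "finite (carrier K)" unfolding K_def carrier_FactGroup using fT by simp
  \<comment> \<open>Pull a faithful action of least degree of the central product back to the direct
    product; its kernel is N.\<close>
  obtain \<rho>0 where \<rho>0: "\<rho>0 \<in> mon K (sym_group (mu K))"
    using group.mon_sym_group_mu_finite[OF gK fK] by blast
  define \<rho> where "\<rho> = (\<lambda>t. \<rho>0 (N #>\<^bsub>G \<times>\<times> H\<^esub> t))"
  have hom: "\<rho> \<in> hom (G \<times>\<times> H) (sym_group (mu K))"
  proof -
    have "\<rho>0 \<in> hom ((G \<times>\<times> H) Mod N) (sym_group (mu K))" using \<rho>0 by (simp add: mon_def K_def)
    from hom_compose[OF N.r_coset_hom_Mod this] show ?thesis by (simp add: \<rho>_def comp_def)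
  qed
  have sub: "G1 \<subseteq> carrier G" "H1 \<subseteq> carrier H"
    using subgroup.subset[OF sG1] subgroup.subset[OF sH1] by auto
  have hom1: "\<rho> \<in> hom (G\<lparr>carrier := G1\<rparr> \<times>\<times> H\<lparr>carrier := H1\<rparr>) (sym_group (mu K))"
  proof (rule homI)
    fix x assume "x \<in> carrier (G\<lparr>carrier := G1\<rparr> \<times>\<times> H\<lparr>carrier := H1\<rparr>)"
    hence x: "x \<in> carrier (G \<times>\<times> H)" using sub by auto
    show "\<rho> x \<in> carrier (sym_group (mu K))" using hom_in_carrier[OF hom x] .
    fix y assume "y \<in> carrier (G\<lparr>carrier := G1\<rparr> \<times>\<times> H\<lparr>carrier := H1\<rparr>)"
    hence y: "y \<in> carrier (G \<times>\<times> H)" using sub by auto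
    have "x \<otimes>\<^bsub>G\<lparr>carrier := G1\<rparr> \<times>\<times> H\<lparr>carrier := H1\<rparr>\<^esub> y = x \<otimes>\<^bsub>G \<times>\<times> H\<^esub> y"
      by (simp add: DirProd_def)
    thus "\<rho> (x \<otimes>\<^bsub>G\<lparr>carrier := G1\<rparr> \<times>\<times> H\<lparr>carrier := H1\<rparr>\<^esub> y) = \<rho> x \<otimes>\<^bsub>sym_group (mu K)\<^esub> \<rho> y"
      using hom_mult[OF hom x y] by simp
  qed
  have \<rho>0one: "\<rho>0 \<one>\<^bsub>K\<^esub> = id"
    using hom_one[OF _ gK sym_group_is_group, of \<rho>0 "mu K"] \<rho>0 by (simp add: mon_def sym_group_one)
  have \<rho>0ker: "x = \<one>\<^bsub>K\<^esub>" if "x \<in> carrier K" "\<rho>0 x = id" for x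
    using \<rho>0 that \<rho>0one monoid.one_closed[OF group.is_monoid[OF gK]] unfolding mon_def inj_on_def by auto
  have kerN: "\<rho> t = id \<longleftrightarrow> t \<in> N" if t: "t \<in> carrier (G \<times>\<times> H)" for t
  proof -
    have tK: "N #>\<^bsub>G \<times>\<times> H\<^esub> t \<in> carrier K" using t by (simp add: K_def carrier_FactGroup)
    have "\<rho> t = id \<longleftrightarrow> N #>\<^bsub>G \<times>\<times> H\<^esub> t = \<one>\<^bsub>K\<^esub>"
    proof
      assume "\<rho> t = id"
      thus "N #>\<^bsub>G \<times>\<times> H\<^esub> t = \<one>\<^bsub>K\<^esub>" using \<rho>0ker[OF tK] by (simp add: \<rho>_def)
    next
      assume e: "N #>\<^bsub>G \<times>\<times> H\<^esub> t = \<one>\<^bsub>K\<^esub>"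
      show "\<rho> t = id" unfolding \<rho>_def e by (rule \<rho>0one)
    qed
    also have "\<dots> \<longleftrightarrow> N #>\<^bsub>G \<times>\<times> H\<^esub> t = N" by (simp add: K_def FactGroup_def)
    also have "\<dots> \<longleftrightarrow> t \<in> N"
      using T.coset_join1[OF _ t N.is_subgroup] T.coset_join2[OF t N.is_subgroup] by blast
    finally show ?thesis .
  qed
  have zc: "z i \<in> center G" "z i \<in> carrier G" "z i \<noteq> \<one>\<^bsub>G\<^esub>" "w i \<in> carrier H" "w i \<noteq> \<one>\<^bsub>H\<^esub>"
    if "i \<in> {1..r}" for i
    using z[OF that] w[OF that] by (auto simp: generates_p_torsion_center_iff center_in_carrier)
  have k1: "\<rho> (z i, w i) = id" if "i \<in> {1..r}" for i
    using kerN[of "(z i, w i)"] zc[OF that] by (simp add: N_def central_kernel_def w_def)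
  have k2: "\<rho> (z i, \<one>\<^bsub>H\<^esub>) \<noteq> id" if "i \<in> {1..r}" for i
    using kerN[of "(z i, \<one>\<^bsub>H\<^esub>)"] zc[OF that] by (auto simp: N_def central_kernel_def w_def)
  have "mu (G\<lparr>carrier := G1\<rparr>) + mu (H\<lparr>carrier := H1\<rparr>) < mu K"
    by (rule mu_sum_less_degree_of_central_action[where z = z and w = w and p = p and I = "{1..r}",
          OF nG1 fG1 nH1 fH1 _ _ assms(9) pr(1,2) assms(15) _ assms(16) _ _ _ _ _ hom1])
      (use assms(7,10,11,17,18) z zr w wr k1 k2 in auto)
  hence less: "mu (G \<times>\<times> H) < mu K"
    using mu_DirProd_le[OF G(1) H(1) G(2) H(2)] mG1 mH1 by simp
  hence "distinguished_kernel (G \<times>\<times> H) (central_kernel G \<phi>)"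
    using N by (simp add: distinguished_kernel_def K_def N_def)
  thus ?thesis
    using less fT T.is_group by (auto simp: exceptional_def central_product_def K_def N_def)
qed

end
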